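(* Let $p$ be an odd prime and let $G$ be a $3$-generated group of nilpotency class at most $2$ and exponent $p$. Then $G$ is either cyclic or capable.
   Context: A group $G$ is capable if there is a group $H$ with $G\cong H/Z(H)$. A group is $3$-generated if it can be generated by $3$ elements (it may need fewer). "Class 2" means class at most 2. *)

theory Defs
  imports "HOL-Algebra.Algebra" "HOL-Computational_Algebra.Primes"
begin

definition group_center :: "('a, 'b) monoid_scheme \<Rightarrow> 'a set" where
  "group_center G = {z \<in> carrier G. \<forall>x \<in> carrier G. z \<otimes>\<^bsub>G\<^esub> x = x \<otimes>\<^bsub>G\<^esub> z}"

definition commutator_subgroup :: "('a, 'b) monoid_scheme \<Rightarrow> 'a set \<Rightarrow> 'a set \<Rightarrow> 'a set" where
  "commutator_subgroup G A B =
     generate G {a \<otimes>\<^bsub>G\<^esub> b \<otimes>\<^bsub>G\<^esub> inv\<^bsub>G\<^esub> a \<otimes>\<^bsub>G\<^esub> inv\<^bsub>G\<^esub> b |a b. a \<in> A \<and> b \<in> B}"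

text \<open>Indexing from 0: \<open>lower_central G n\<close> is the term usually written \<open>\<gamma>\<close> with index \<open>n + 1\<close>.\<close>

primrec lower_central :: "('a, 'b) monoid_scheme \<Rightarrow> nat \<Rightarrow> 'a set" where
  "lower_central G 0 = carrier G"
| "lower_central G (Suc n) = commutator_subgroup G (lower_central G n) (carrier G)"

definition class_at_most :: "('a, 'b) monoid_scheme \<Rightarrow> nat \<Rightarrow> bool" where
  "class_at_most G c \<longleftrightarrow> lower_central G c = {\<one>\<^bsub>G\<^esub>}"

definition has_exponent :: "('a, 'b) monoid_scheme \<Rightarrow> nat \<Rightarrow> bool" where
  "has_exponent G n \<longleftrightarrow>
     0 < n \<and> (\<forall>x \<in> carrier G. x [^]\<^bsub>G\<^esub> n = \<one>\<^bsub>G\<^esub>) \<and>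
     (\<forall>m. 0 < m \<and> (\<forall>x \<in> carrier G. x [^]\<^bsub>G\<^esub> m = \<one>\<^bsub>G\<^esub>) \<longrightarrow> n \<le> m)"

definition n_generated :: "('a, 'b) monoid_scheme \<Rightarrow> nat \<Rightarrow> bool" where
  "n_generated G n \<longleftrightarrow>
     (\<exists>S. S \<subseteq> carrier G \<and> finite S \<and> card S \<le> n \<and> generate G S = carrier G)"

text \<open>HOL cannot quantify over all types, so the witness \<open>H\<close> ranges over the groups whose carrier
  is contained in one fixed type. Lists over the element type of \<open>G\<close> are large enough for this to
  lose nothing: the subgroup of \<open>H\<close> generated by a transversal of its centre has the same central
  quotient, and its elements are words in elements of \<open>G\<close>. The lemma \<open>capableI\<close> below
  gives the definition back for a witness over an arbitrary type.\<close>

definition capable :: "('a, 'b) monoid_scheme \<Rightarrow> bool" where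
  "capable G \<longleftrightarrow> (\<exists>H :: 'a list monoid. group H \<and> G \<cong> H Mod group_center H)"

lemma group_center_normal:
  assumes "group H" shows "group_center H \<lhd> H"
proof -
  interpret H: group H by fact
  have "subgroup (group_center H) H"
  proof (rule H.subgroupI)
    show "inv\<^bsub>H\<^esub> a \<in> group_center H" if "a \<in> group_center H" for a
    proof -
      have a: "a \<in> carrier H" and c: "\<And>x. x \<in> carrier H \<Longrightarrow> a \<otimes>\<^bsub>H\<^esub> x = x \<otimes>\<^bsub>H\<^esub> a"
        using that by (auto simp: group_center_def)
      have "inv\<^bsub>H\<^esub> a \<otimes>\<^bsub>H\<^esub> x = x \<otimes>\<^bsub>H\<^esub> inv\<^bsub>H\<^esub> a" if x: "x \<in> carrier H" for x
      proof -
        have "inv\<^bsub>H\<^esub> a \<otimes>\<^bsub>H\<^esub> x = inv\<^bsub>H\<^esub> (inv\<^bsub>H\<^esub> x \<otimes>\<^bsub>H\<^esub> a)" using a x by (simp add: H.inv_mult_group)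
        also have "inv\<^bsub>H\<^esub> x \<otimes>\<^bsub>H\<^esub> a = a \<otimes>\<^bsub>H\<^esub> inv\<^bsub>H\<^esub> x" using c x by simp
        also have "inv\<^bsub>H\<^esub> \<dots> = x \<otimes>\<^bsub>H\<^esub> inv\<^bsub>H\<^esub> a" using a x by (simp add: H.inv_mult_group)
        finally show ?thesis .
      qed
      then show ?thesis using a by (simp add: group_center_def)
    qed
    show "a \<otimes>\<^bsub>H\<^esub> b \<in> group_center H" if "a \<in> group_center H" "b \<in> group_center H" for a b
    proof -
      have a: "a \<in> carrier H" "b \<in> carrier H" using that by (auto simp: group_center_def)
      have "a \<otimes>\<^bsub>H\<^esub> b \<otimes>\<^bsub>H\<^esub> x = x \<otimes>\<^bsub>H\<^esub> (a \<otimes>\<^bsub>H\<^esub> b)" if x: "x \<in> carrier H" for x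
      proof -
        have "a \<otimes>\<^bsub>H\<^esub> b \<otimes>\<^bsub>H\<^esub> x = a \<otimes>\<^bsub>H\<^esub> (b \<otimes>\<^bsub>H\<^esub> x)" using a x by (simp add: H.m_assoc)
        also have "b \<otimes>\<^bsub>H\<^esub> x = x \<otimes>\<^bsub>H\<^esub> b" using \<open>b \<in> group_center H\<close> x by (simp add: group_center_def)
        also have "a \<otimes>\<^bsub>H\<^esub> (x \<otimes>\<^bsub>H\<^esub> b) = a \<otimes>\<^bsub>H\<^esub> x \<otimes>\<^bsub>H\<^esub> b" using a x by (simp add: H.m_assoc)
        also have "a \<otimes>\<^bsub>H\<^esub> x = x \<otimes>\<^bsub>H\<^esub> a" using \<open>a \<in> group_center H\<close> x by (simp add: group_center_def)
        also have "x \<otimes>\<^bsub>H\<^esub> a \<otimes>\<^bsub>H\<^esub> b = x \<otimes>\<^bsub>H\<^esub> (a \<otimes>\<^bsub>H\<^esub> b)" using a x by (simp add: H.m_assoc)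
        finally show ?thesis .
      qed
      then show ?thesis using a by (simp add: group_center_def)
    qed
  next
    have "\<one>\<^bsub>H\<^esub> \<in> group_center H" by (simp add: group_center_def)
    then show "group_center H \<noteq> {}" by blast
  qed (auto simp: group_center_def)
  moreover have "x \<otimes>\<^bsub>H\<^esub> z \<otimes>\<^bsub>H\<^esub> inv\<^bsub>H\<^esub> x \<in> group_center H"
    if x: "x \<in> carrier H" and z: "z \<in> group_center H" for x z
  proof -
    have zc: "z \<in> carrier H" "x \<otimes>\<^bsub>H\<^esub> z = z \<otimes>\<^bsub>H\<^esub> x" using x z by (auto simp: group_center_def)
    have "x \<otimes>\<^bsub>H\<^esub> z \<otimes>\<^bsub>H\<^esub> inv\<^bsub>H\<^esub> x = z" using x zc by (simp add: H.m_assoc)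
    then show ?thesis using z by simp
  qed
  ultimately show ?thesis by (simp add: H.normal_inv_iff)
qed

lemma capableI:
  fixes G :: "('a, 'b) monoid_scheme" and H :: "('h, 'c) monoid_scheme"
  assumes G: "group G" and H: "group H" and GH: "G \<cong> H Mod group_center H"
  shows "capable G"
proof -
  interpret G: group G by fact
  interpret H: group H by fact
  define Z where "Z = group_center H"
  interpret Z: normal Z H unfolding Z_def by (rule group_center_normal[OF H])
  interpret Q: group "H Mod Z" by (rule Z.factorgroup_is_group)
  obtain f where f: "f \<in> iso G (H Mod Z)" using GH by (auto simp: is_iso_def Z_def)
  have f_car: "f g \<in> carrier (H Mod Z)" if "g \<in> carrier G" for g
    using f that by (auto simp: iso_def hom_def)
  have f_im: "f ` carrier G = carrier (H Mod Z)" using f unfolding iso_def bij_betw_def by blast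
  have f_surj: "\<exists>g \<in> carrier G. f g = c" if "c \<in> carrier (H Mod Z)" for c
    using that unfolding f_im[symmetric] by blast
  have f_one: "f \<one>\<^bsub>G\<^esub> = Z"
    using hom_one[of f G "H Mod Z"] f G Q.is_group by (auto simp: iso_def)
  have "\<exists>r. \<forall>g \<in> carrier G. r g \<in> carrier H \<and> Z #>\<^bsub>H\<^esub> r g = f g"
    using f_car by (intro bchoice) (force simp: carrier_FactGroup)
  then obtain r0 where r0: "\<And>g. g \<in> carrier G \<Longrightarrow> r0 g \<in> carrier H \<and> Z #>\<^bsub>H\<^esub> r0 g = f g" by blast
  define r where "r = r0(\<one>\<^bsub>G\<^esub> := \<one>\<^bsub>H\<^esub>)"
  have r1: "r \<one>\<^bsub>G\<^esub> = \<one>\<^bsub>H\<^esub>" by (simp add: r_def)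
  have r: "r g \<in> carrier H" "Z #>\<^bsub>H\<^esub> r g = f g" if "g \<in> carrier G" for g
    using r0[OF that] f_one Z.subset by (auto simp: r_def)

  define K where "K = generate H (r ` carrier G)"
  have K: "subgroup K H" unfolding K_def using r by (intro H.generate_is_subgroup) auto
  interpret K: subgroup K H by fact

  define ev :: "bool \<Rightarrow> 'a list \<Rightarrow> 'h" where
    "ev = (\<lambda>b xs. rec_list (\<lambda>_. \<one>\<^bsub>H\<^esub>)
      (\<lambda>x _ k b. (if b then r x else inv\<^bsub>H\<^esub> (r x)) \<otimes>\<^bsub>H\<^esub> k (\<not> b)) xs b)"
  have ev_Nil: "ev b [] = \<one>\<^bsub>H\<^esub>" for b by (simp add: ev_def)
  have ev_Cons: "ev b (x # xs) = (if b then r x else inv\<^bsub>H\<^esub> (r x)) \<otimes>\<^bsub>H\<^esub> ev (\<not> b) xs" for b x xs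
    by (simp add: ev_def)
  have ev_car: "ev b xs \<in> carrier H" if "set xs \<subseteq> carrier G" for b xs
    using that by (induction xs arbitrary: b) (auto simp: ev_Nil ev_Cons r)
  have ev_append: "ev b (xs @ ys) = ev b xs \<otimes>\<^bsub>H\<^esub> ev (if even (length xs) then b else \<not> b) ys"
    if "set xs \<subseteq> carrier G" "set ys \<subseteq> carrier G" for b xs ys
    using that(1)
  proof (induction xs arbitrary: b)
    case Nil
    then show ?case using ev_car that(2) by (simp add: ev_Nil)
  next
    case (Cons x xs)
    then show ?case using ev_car that(2) r by (auto simp: ev_Cons H.m_assoc)
  qed
  have K_ev: "\<exists>xs. set xs \<subseteq> carrier G \<and> ev True xs = k" if "k \<in> K" for k
    using that unfolding K_def
  proof (induction rule: generate.induct)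
    case one
    show ?case by (rule exI[of _ "[]"]) (simp add: ev_Nil)
  next
    case (incl h)
    then obtain g where "g \<in> carrier G" "h = r g" by auto
    then show ?case by (intro exI[of _ "[g]"]) (simp add: ev_Nil ev_Cons r)
  next
    case (inv h)
    then obtain g where "g \<in> carrier G" "h = r g" by auto
    then show ?case by (intro exI[of _ "[\<one>\<^bsub>G\<^esub>, g]"]) (simp add: ev_Nil ev_Cons r r1)
  next
    case (eng h1 h2)
    then obtain xs ys where xs: "set xs \<subseteq> carrier G" "ev True xs = h1"
      and ys: "set ys \<subseteq> carrier G" "ev True ys = h2" by blast
    show ?case
    proof (cases "even (length xs)")
      case True
      then show ?thesis using xs ys by (intro exI[of _ "xs @ ys"]) (simp add: ev_append)
    next
      case False
      then show ?thesis using xs ys ev_car[of ys]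
        by (intro exI[of _ "xs @ \<one>\<^bsub>G\<^esub> # ys"]) (auto simp: ev_append ev_Cons r1)
    qed
  qed
  obtain e where e: "\<And>k. k \<in> K \<Longrightarrow> ev True (e k) = k" using K_ev by metis
  define d where "d = ev True"
  have d: "d (e k) = k" if "k \<in> K" for k using e that by (simp add: d_def)

  define L :: "'a list monoid" where
    "L = \<lparr>carrier = e ` K, monoid.mult = (\<lambda>x y. e (d x \<otimes>\<^bsub>H\<^esub> d y)), one = e \<one>\<^bsub>H\<^esub>\<rparr>"
  have L: "group L"
  proof (rule groupI)
    show "\<exists>y \<in> carrier L. y \<otimes>\<^bsub>L\<^esub> x = \<one>\<^bsub>L\<^esub>" if x: "x \<in> carrier L" for x
    proof -
      obtain k where k: "k \<in> K" "x = e k" using x by (auto simp: L_def)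
      then show ?thesis by (intro bexI[of _ "e (inv\<^bsub>H\<^esub> k)"]) (auto simp: L_def d)
    qed
  qed (auto simp: L_def d H.m_assoc K.mem_carrier)
  interpret L: group L by fact

  define h where "h = (\<lambda>x. Z #>\<^bsub>H\<^esub> d x)"
  have h: "h \<in> hom L (H Mod Z)"
    by (rule homI) (auto simp: h_def L_def d K.mem_carrier carrier_FactGroup Z.rcos_sum)
  interpret h: group_hom L "H Mod Z" h
    using h by (simp add: group_hom_def group_hom_axioms_def L.is_group Q.is_group)
  have cover: "\<exists>k \<in> K. Z #>\<^bsub>H\<^esub> x = Z #>\<^bsub>H\<^esub> k" if "x \<in> carrier H" for x
  proof -
    have "Z #>\<^bsub>H\<^esub> x \<in> carrier (H Mod Z)" using that by (auto simp: carrier_FactGroup)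
    then obtain g where g: "g \<in> carrier G" "f g = Z #>\<^bsub>H\<^esub> x" using f_surj by blast
    moreover have "r g \<in> K" unfolding K_def using g by (auto intro: generate.incl)
    ultimately show ?thesis using r by metis
  qed
  have surj: "h ` carrier L = carrier (H Mod Z)"
  proof
    show "h ` carrier L \<subseteq> carrier (H Mod Z)" using h.hom_closed by auto
    show "carrier (H Mod Z) \<subseteq> h ` carrier L"
      using cover by (force simp: carrier_FactGroup h_def L_def d)
  qed
  have kernel_Z: "h (e k) = Z \<longleftrightarrow> k \<in> Z" if "k \<in> K" for k
  proof -
    have "k \<in> Z #>\<^bsub>H\<^esub> k" by (rule H.rcos_self[OF K.mem_carrier[OF that] Z.subgroup_axioms])
    moreover have "k \<in> Z \<Longrightarrow> Z #>\<^bsub>H\<^esub> k = Z" by (rule Z.rcos_const[OF H])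
    ultimately show ?thesis unfolding h_def d[OF that] by blast
  qed
  have K_Z: "k \<in> Z \<longleftrightarrow> (\<forall>l \<in> K. k \<otimes>\<^bsub>H\<^esub> l = l \<otimes>\<^bsub>H\<^esub> k)" if k: "k \<in> K" for k
  proof
    assume "k \<in> Z"
    then show "\<forall>l \<in> K. k \<otimes>\<^bsub>H\<^esub> l = l \<otimes>\<^bsub>H\<^esub> k"
      using K.mem_carrier unfolding Z_def group_center_def by blast
  next
    assume comm: "\<forall>l \<in> K. k \<otimes>\<^bsub>H\<^esub> l = l \<otimes>\<^bsub>H\<^esub> k"
    have "k \<otimes>\<^bsub>H\<^esub> x = x \<otimes>\<^bsub>H\<^esub> k" if x: "x \<in> carrier H" for x
    proof -
      obtain l where l: "l \<in> K" "Z #>\<^bsub>H\<^esub> x = Z #>\<^bsub>H\<^esub> l" using cover x by blast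
      then have "x \<in> Z #>\<^bsub>H\<^esub> l" using H.rcos_self[OF x Z.subgroup_axioms] by simp
      then obtain z where z: "z \<in> Z" "x = z \<otimes>\<^bsub>H\<^esub> l" by (auto simp: r_coset_def)
      have zc: "z \<in> carrier H" "z \<otimes>\<^bsub>H\<^esub> k = k \<otimes>\<^bsub>H\<^esub> z" 
        using z(1) K.mem_carrier[OF k] unfolding Z_def group_center_def by blast+
      have kc: "k \<in> carrier H" "l \<in> carrier H" using k l K.mem_carrier by auto
      have "k \<otimes>\<^bsub>H\<^esub> x = (k \<otimes>\<^bsub>H\<^esub> z) \<otimes>\<^bsub>H\<^esub> l"
        unfolding z(2) by (rule H.m_assoc[symmetric, OF kc(1) zc(1) kc(2)])
      also have "\<dots> = (z \<otimes>\<^bsub>H\<^esub> k) \<otimes>\<^bsub>H\<^esub> l" by (simp only: zc(2))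
      also have "\<dots> = z \<otimes>\<^bsub>H\<^esub> (k \<otimes>\<^bsub>H\<^esub> l)" by (rule H.m_assoc[OF zc(1) kc])
      also have "\<dots> = z \<otimes>\<^bsub>H\<^esub> (l \<otimes>\<^bsub>H\<^esub> k)" by (rule arg_cong[OF bspec[OF comm l(1)]])
      also have "\<dots> = x \<otimes>\<^bsub>H\<^esub> k"
        unfolding z(2) by (rule H.m_assoc[symmetric, OF zc(1) kc(2) kc(1)])
      finally show ?thesis .
    qed
    then show "k \<in> Z" using K.mem_carrier[OF k] unfolding Z_def group_center_def by blast
  qed
  have e_inj: "e k = e l \<longleftrightarrow> k = l" if "k \<in> K" "l \<in> K" for k l using d that by metis
  have ker: "kernel L (H Mod Z) h = group_center L"
  proof -
    have "e k \<in> kernel L (H Mod Z) h \<longleftrightarrow> e k \<in> group_center L" if k: "k \<in> K" for k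
    proof -
      have "e k \<in> kernel L (H Mod Z) h \<longleftrightarrow> k \<in> Z"
        using k kernel_Z by (auto simp: kernel_def L_def)
      also have "\<dots> \<longleftrightarrow> (\<forall>l \<in> K. e (k \<otimes>\<^bsub>H\<^esub> l) = e (l \<otimes>\<^bsub>H\<^esub> k))"
        using k by (simp add: K_Z e_inj)
      also have "\<dots> \<longleftrightarrow> e k \<in> group_center L"
        using k by (auto simp: group_center_def L_def d)
      finally show ?thesis .
    qed
    then show ?thesis by (auto simp: kernel_def group_center_def L_def)
  qed
  have "L Mod group_center L \<cong> H Mod Z" using h.FactGroup_iso[OF surj] ker by simp
  moreover have "group (L Mod group_center L)"
    by (rule normal.factorgroup_is_group[OF group_center_normal[OF L]])
  ultimately have "H Mod Z \<cong> L Mod group_center L" by (rule group.iso_sym[rotated])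
  moreover have "G \<cong> H Mod Z" using f by (auto simp: is_iso_def)
  ultimately have "G \<cong> L Mod group_center L" by (blast intro: iso_trans)
  with L show ?thesis unfolding capable_def by blast
qed

end

theory Submission
  imports Defs
begin

text \<open>
  The proof rests on two facts. Capability passes from quotients to the group: if every
  \<open>g \<noteq> \<one>\<close> survives in some capable quotient of \<open>G\<close>, then \<open>G\<close> is capable
  (\<open>residually_capable_imp_capable\<close>). And the group in question, unless it is cyclic, has enough
  quotients of two very small kinds that are visibly capable: \<open>C\<^sub>p \<times> C\<^sub>p\<close>, and the Heisenberg group
  of order \<open>p\<^sup>3\<close>.

  To find such quotients, choose a normal subgroup \<open>N\<close> maximal among those that avoid \<open>g\<close>. Then
  the image of \<open>g\<close> lies in every nontrivial normal subgroup of \<open>Q = G / N\<close>, which forces the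
  centre of \<open>Q\<close> to be cyclic of order \<open>p\<close>.

  If \<open>Q\<close> is not abelian, the commutator map is a nondegenerate alternating form on the
  \<open>F\<^sub>p\<close>-space \<open>Q / Z(Q)\<close>, whose dimension is therefore even. Three generators leave only dimension
  two, so \<open>Q\<close> is the Heisenberg group. This is where the bound on the number of generators
  is used; \<open>capable_if_monolithic_nonabelian\<close> carries out the argument on generators.

  If \<open>Q\<close> is abelian, it has order \<open>p\<close> and is not capable, so \<open>N\<close> has to be cut down. It contains
  the derived subgroup \<open>G'\<close>, and it differs from \<open>G'\<close>, since otherwise \<open>G = \<langle>g\<rangle> G'\<close> with \<open>G'\<close>
  central would be cyclic. For \<open>u \<in> N - G'\<close> a normal subgroup \<open>M \<supseteq> G'\<close> maximal avoiding \<open>u\<close>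
  gives \<open>G / (N \<inter> M) \<cong> C\<^sub>p \<times> C\<^sub>p\<close> (\<open>exists_rank_two_abelian_quotient\<close>).

  The witnesses for the two small groups are explicit. \<open>C\<^sub>p \<times> C\<^sub>p\<close> is the central quotient of the
  Heisenberg group, and the Heisenberg group is the central quotient of a group of order \<open>p\<^sup>4\<close> and
  maximal class, for which \<open>p\<close> has to be odd.
\<close>

section \<open>Capability from quotients\<close>

text \<open>Recognises capability from an explicit central extension, so that no isomorphism with a
  quotient has to be written down.\<close>

lemma capable_if_kernel_is_center:
  assumes "group E" "group Q" "\<psi> \<in> hom E Q" "\<psi> ` carrier E = carrier Q"
    and "kernel E Q \<psi> = group_center E"
  shows "capable Q"
proof -
  interpret \<psi>: group_hom E Q \<psi>
    using assms by (simp add: group_hom_def group_hom_axioms_def)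
  have "E Mod group_center E \<cong> Q" using \<psi>.FactGroup_iso assms by simp
  then have "Q \<cong> E Mod group_center E"
    by (rule group.iso_sym[OF normal.factorgroup_is_group[OF group_center_normal[OF assms(1)]]])
  then show ?thesis using assms capableI by blast
qed

lemma (in normal) quotient_hom: "group_hom G (G Mod H) (\<lambda>x. H #> x)"
  using r_coset_hom_Mod factorgroup_is_group
  by (simp add: group_hom_def group_hom_axioms_def is_group)

lemma (in normal) coset_eq_self_iff: "x \<in> carrier G \<Longrightarrow> H #> x = H \<longleftrightarrow> x \<in> H"
  using coset_join1[OF _ _ subgroup_axioms] coset_join2[OF _ subgroup_axioms] by blast

text \<open>The witness is a fibre product. For every \<open>g \<noteq> \<one>\<close> take a quotient \<open>G / N\<close> in which \<open>g\<close>
  survives, and \<open>E\<close> with \<open>E / Z(E) \<cong> G / N\<close>; let \<open>H\<close> consist of the families in the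
  product of all these \<open>E\<close> whose components come from one common element of \<open>G\<close>. That element is
  determined by the family because the \<open>N\<close> intersect trivially, which gives a map \<open>H \<rightarrow> G\<close>. As \<open>H\<close>
  projects onto every factor, a family is central in \<open>H\<close> exactly when all its components are
  central, that is, when it maps to \<open>\<one>\<close>.\<close>

lemma residually_capable_imp_capable:
  fixes G :: "('a, 'b) monoid_scheme"
  assumes G: "group G"
    and sep: "\<And>g. g \<in> carrier G \<Longrightarrow> g \<noteq> \<one>\<^bsub>G\<^esub> \<Longrightarrow> \<exists>N. N \<lhd> G \<and> g \<notin> N \<and> capable (G Mod N)"
  shows "capable G"
proof -
  interpret G: group G by fact
  define I where "I = carrier G - {\<one>\<^bsub>G\<^esub>}"
  define W where "W g N E \<psi> \<longleftrightarrow> N \<lhd> G \<and> g \<notin> N \<and> group E \<and> \<psi> \<in> hom E (G Mod N) \<and>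
     \<psi> ` carrier E = carrier (G Mod N) \<and> kernel E (G Mod N) \<psi> = group_center E"
    for g N and E :: "'a set list monoid" and \<psi>
  have "\<exists>N E \<psi>. W g N E \<psi>"
    if g: "g \<in> I" for g
  proof -
    obtain N where N: "N \<lhd> G" "g \<notin> N" "capable (G Mod N)" using sep[of g] g unfolding I_def by blast
    then obtain E :: "'a set list monoid" where E: "group E" "G Mod N \<cong> E Mod group_center E"
      by (auto simp: capable_def)
    interpret Z: normal "group_center E" E by (rule group_center_normal[OF E(1)])
    have "E Mod group_center E \<cong> G Mod N"
      by (rule group.iso_sym[OF normal.factorgroup_is_group[OF N(1)] E(2)])
    then obtain f where f: "f \<in> iso (E Mod group_center E) (G Mod N)" by (auto simp: is_iso_def)
    interpret q: group_hom E "E Mod group_center E" "\<lambda>x. group_center E #>\<^bsub>E\<^esub> x"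
      by (rule Z.quotient_hom)
    interpret f: group_hom "E Mod group_center E" "G Mod N" f
      using f Z.factorgroup_is_group normal.factorgroup_is_group[OF N(1)]
      by (simp add: group_hom_def group_hom_axioms_def iso_def)
    define \<psi> where "\<psi> = f \<circ> (\<lambda>x. group_center E #>\<^bsub>E\<^esub> x)"
    have "\<psi> \<in> hom E (G Mod N)"
      unfolding \<psi>_def by (rule hom_compose[OF q.homh f.homh])
    moreover have "\<psi> ` carrier E = carrier (G Mod N)"
      using f carrier_FactGroup[of E "group_center E"] unfolding \<psi>_def image_comp[symmetric] iso_def bij_betw_def by simp
    moreover have "kernel E (G Mod N) \<psi> = group_center E"
    proof -
      have inj: "inj_on f (carrier (E Mod group_center E))" using f by (simp add: iso_def bij_betw_def)
      have "f (group_center E #>\<^bsub>E\<^esub> x) = N \<longleftrightarrow> x \<in> group_center E" if "x \<in> carrier E" for x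
      proof -
        have "f (group_center E #>\<^bsub>E\<^esub> x) = N \<longleftrightarrow> f (group_center E #>\<^bsub>E\<^esub> x) = f (group_center E)"
          using f.hom_one by simp
        also have "\<dots> \<longleftrightarrow> group_center E #>\<^bsub>E\<^esub> x = group_center E"
          using inj_on_eq_iff[OF inj q.hom_closed[OF that]]
            group.is_monoid[OF Z.factorgroup_is_group, THEN monoid.one_closed] by simp
        also have "\<dots> \<longleftrightarrow> x \<in> group_center E" by (rule Z.coset_eq_self_iff[OF that])
        finally show ?thesis .
      qed
      then show ?thesis using Z.subset by (auto simp: kernel_def \<psi>_def)
    qed
    ultimately show ?thesis using N E(1) unfolding W_def by blast
  qed
  then have W_ex: "\<exists>N E \<psi>. W g N E \<psi>" if "g \<in> I" for g using that .
  define N where "N g = (SOME N. \<exists>E \<psi>. W g N E \<psi>)" for g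
  define E where "E g = (SOME E. \<exists>\<psi>. W g (N g) E \<psi>)" for g
  define \<psi> where "\<psi> g = (SOME \<psi>. W g (N g) (E g) \<psi>)" for g
  have W: "W g (N g) (E g) (\<psi> g)" if "g \<in> I" for g
  proof -
    have "\<exists>E \<psi>. W g (N g) E \<psi>" unfolding N_def by (rule someI_ex[OF W_ex[OF that]])
    then have "\<exists>\<psi>. W g (N g) (E g) \<psi>" unfolding E_def by (rule someI_ex)
    then show ?thesis unfolding \<psi>_def by (rule someI_ex)
  qed
  have N: "\<And>g. g \<in> I \<Longrightarrow> N g \<lhd> G" "\<And>g. g \<in> I \<Longrightarrow> g \<notin> N g"
    and E: "\<And>g. g \<in> I \<Longrightarrow> group (E g)"
    and hom: "\<And>g. g \<in> I \<Longrightarrow> \<psi> g \<in> hom (E g) (G Mod N g)"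
    and surj: "\<And>g. g \<in> I \<Longrightarrow> \<psi> g ` carrier (E g) = carrier (G Mod N g)"
    and ker: "\<And>g. g \<in> I \<Longrightarrow> kernel (E g) (G Mod N g) (\<psi> g) = group_center (E g)"
    using W unfolding W_def by blast+
  define P where "P = product_group I E"
  interpret P: group P unfolding P_def using E by simp
  have \<psi>: "group_hom (E g) (G Mod N g) (\<psi> g)" if "g \<in> I" for g
    using E[OF that] hom[OF that] normal.factorgroup_is_group[OF N(1)[OF that]]
    by (simp add: group_hom_def group_hom_axioms_def)
  \<comment> \<open>The family \<open>e\<close> lies over the element \<open>x\<close>.\<close>
  define rel where "rel e x \<longleftrightarrow> e \<in> carrier P \<and> x \<in> carrier G \<and> (\<forall>g\<in>I. \<psi> g (e g) = N g #>\<^bsub>G\<^esub> x)" for e x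
  have q: "group_hom G (G Mod N g) (\<lambda>x. N g #>\<^bsub>G\<^esub> x)" if "g \<in> I" for g
    by (rule normal.quotient_hom[OF N(1)[OF that]])
  have rel_mult: "rel (e \<otimes>\<^bsub>P\<^esub> e') (x \<otimes>\<^bsub>G\<^esub> x')" if "rel e x" "rel e' x'" for e e' x x'
  proof -
    have "\<psi> g ((e \<otimes>\<^bsub>P\<^esub> e') g) = N g #>\<^bsub>G\<^esub> (x \<otimes>\<^bsub>G\<^esub> x')" if g: "g \<in> I" for g
    proof -
      have "e g \<in> carrier (E g)" "e' g \<in> carrier (E g)"
        using \<open>rel e x\<close> \<open>rel e' x'\<close> g by (auto simp: rel_def P_def)
      then show ?thesis
        using g \<open>rel e x\<close> \<open>rel e' x'\<close> group_hom.hom_mult[OF \<psi>[OF g]] group_hom.hom_mult[OF q[OF g]]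
        by (auto simp: rel_def P_def)
    qed
    then show ?thesis using that P.m_closed by (simp add: rel_def)
  qed
  have rel_inv: "rel (inv\<^bsub>P\<^esub> e) (inv\<^bsub>G\<^esub> x)" if "rel e x" for e x
  proof -
    have "\<psi> g ((inv\<^bsub>P\<^esub> e) g) = N g #>\<^bsub>G\<^esub> (inv\<^bsub>G\<^esub> x)" if g: "g \<in> I" for g
    proof -
      have eg: "e g \<in> carrier (E g)" and e: "e \<in> carrier (product_group I E)"
        using \<open>rel e x\<close> g by (auto simp: rel_def P_def)
      have "(inv\<^bsub>P\<^esub> e) g = inv\<^bsub>E g\<^esub> (e g)" using e E g unfolding P_def by simp
      then show ?thesis
        using eg g \<open>rel e x\<close> group_hom.hom_inv[OF \<psi>[OF g]] group_hom.hom_inv[OF q[OF g]]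
        by (auto simp: rel_def)
    qed
    then show ?thesis using that P.inv_closed by (simp add: rel_def)
  qed
  have rel_unique: "x = y" if "rel e x" "rel e y" for e x y
  proof (rule ccontr)
    assume "x \<noteq> y"
    define g where "g = x \<otimes>\<^bsub>G\<^esub> inv\<^bsub>G\<^esub> y"
    have c: "x \<in> carrier G" "y \<in> carrier G" using that by (auto simp: rel_def)
    have g: "g \<in> I" using c \<open>x \<noteq> y\<close> G.inv_solve_right[of "\<one>\<^bsub>G\<^esub>" x y] by (auto simp: g_def I_def)
    interpret q: group_hom G "G Mod N g" "\<lambda>x. N g #>\<^bsub>G\<^esub> x" by (rule q[OF g])
    have eq: "N g #>\<^bsub>G\<^esub> x = N g #>\<^bsub>G\<^esub> y" using that g by (simp add: rel_def)
    have "N g #>\<^bsub>G\<^esub> g = N g #>\<^bsub>G\<^esub> (x \<otimes>\<^bsub>G\<^esub> inv\<^bsub>G\<^esub> y)"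
      by (rule arg_cong[OF g_def])
    also have "\<dots> = (N g #>\<^bsub>G\<^esub> y) \<otimes>\<^bsub>G Mod N g\<^esub> inv\<^bsub>G Mod N g\<^esub> (N g #>\<^bsub>G\<^esub> y)"
      using c eq by (simp only: q.hom_mult q.hom_inv G.inv_closed)
    also have "\<dots> = N g" 
      by (rule trans[OF q.H.r_inv[OF q.hom_closed[OF c(2)]] one_FactGroup])
    finally show False using normal.coset_eq_self_iff[OF N(1)[OF g]] N(2)[OF g] g by (auto simp: I_def)
  qed
  have one_rel: "rel \<one>\<^bsub>P\<^esub> \<one>\<^bsub>G\<^esub>"
    using rel_mult rel_inv group_hom.hom_one[OF \<psi>] group_hom.hom_one[OF q]
    by (auto simp: rel_def P_def E group.is_monoid)
  define S where "S = {e. \<exists>x. rel e x}"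
  have S: "subgroup S P"
  proof (rule P.subgroupI)
    show "S \<noteq> {}" using one_rel by (auto simp: S_def)
    show "S \<subseteq> carrier P" by (auto simp: S_def rel_def)
    show "inv\<^bsub>P\<^esub> e \<in> S" if e: "e \<in> S" for e
    proof -
      obtain x where "rel e x" using e by (auto simp: S_def)
      then have "rel (inv\<^bsub>P\<^esub> e) (inv\<^bsub>G\<^esub> x)" by (rule rel_inv)
      then show ?thesis by (auto simp: S_def)
    qed
    show "e \<otimes>\<^bsub>P\<^esub> f \<in> S" if ef: "e \<in> S" "f \<in> S" for e f
    proof -
      obtain x y where "rel e x" "rel f y" using ef by (auto simp: S_def)
      then have "rel (e \<otimes>\<^bsub>P\<^esub> f) (x \<otimes>\<^bsub>G\<^esub> y)" by (rule rel_mult)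
      then show ?thesis by (auto simp: S_def)
    qed
  qed
  define H where "H = P\<lparr>carrier := S\<rparr>"
  interpret H: group H unfolding H_def by (rule P.subgroup_imp_group[OF S])
  define \<pi> where "\<pi> e = (THE x. rel e x)" for e
  have \<pi>: "\<pi> e = x" if "rel e x" for e x
    unfolding \<pi>_def by (rule the_equality) (rule that, rule rel_unique[OF _ that])
  have \<pi>_rel: "rel e (\<pi> e)" if e: "e \<in> carrier H" for e
  proof -
    obtain x where x: "rel e x" using e by (auto simp: H_def S_def)
    then show ?thesis by (simp only: \<pi>[OF x])
  qed
  have \<pi>_hom: "\<pi> \<in> hom H G"
  proof (rule homI)
    show "\<pi> e \<in> carrier G" if "e \<in> carrier H" for e
      using \<pi>_rel[OF that] by (simp add: rel_def)
    show "\<pi> (e \<otimes>\<^bsub>H\<^esub> f) = \<pi> e \<otimes>\<^bsub>G\<^esub> \<pi> f" if "e \<in> carrier H" "f \<in> carrier H" for e f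
      using \<pi>[OF rel_mult[OF \<pi>_rel[OF that(1)] \<pi>_rel[OF that(2)]]] by (simp add: H_def)
  qed
  \<comment> \<open>Prescribing one component still leaves a family in \<open>H\<close>: \<open>H\<close> projects onto every factor.\<close>
  have lift: "\<exists>e. rel e x \<and> e i = a"
    if x: "x \<in> carrier G" and i: "i \<in> I" and a: "a \<in> carrier (E i)" "\<psi> i a = N i #>\<^bsub>G\<^esub> x" for x i a
  proof -
    have "\<exists>b. b \<in> carrier (E g) \<and> \<psi> g b = N g #>\<^bsub>G\<^esub> x" if "g \<in> I" for g
    proof -
      have "N g #>\<^bsub>G\<^esub> x \<in> \<psi> g ` carrier (E g)"
        unfolding surj[OF that] using x by (simp add: carrier_FactGroup)
      then show ?thesis by auto
    qed
    then obtain b where b: "\<And>g. g \<in> I \<Longrightarrow> b g \<in> carrier (E g) \<and> \<psi> g (b g) = N g #>\<^bsub>G\<^esub> x"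
      using bchoice[of I "\<lambda>g b. b \<in> carrier (E g) \<and> \<psi> g b = N g #>\<^bsub>G\<^esub> x"] by blast
    have "rel (restrict (b(i := a)) I) x"
      using b a x by (auto simp: rel_def P_def)
    then show ?thesis using i by fastforce
  qed
  have \<pi>_surj: "\<pi> ` carrier H = carrier G"
  proof
    show "\<pi> ` carrier H \<subseteq> carrier G" using \<pi>_hom by (auto simp: hom_def)
    show "carrier G \<subseteq> \<pi> ` carrier H"
    proof
      fix x assume x: "x \<in> carrier G"
      have "\<exists>e. rel e x"
      proof (cases "I = {}")
        case True
        then have "x = \<one>\<^bsub>G\<^esub>" using x by (auto simp: I_def)
        then show ?thesis using one_rel by blast
      next
        case False
        then obtain i where i: "i \<in> I" by blast
        have "N i #>\<^bsub>G\<^esub> x \<in> \<psi> i ` carrier (E i)"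
          unfolding surj[OF i] using x by (simp add: carrier_FactGroup)
        then obtain a where "a \<in> carrier (E i)" "\<psi> i a = N i #>\<^bsub>G\<^esub> x" by (metis imageE)
        then show ?thesis using lift[OF x i] by blast
      qed
      then obtain e where "rel e x" by blast
      then have "e \<in> carrier H" "\<pi> e = x" using \<pi>[of e x] by (auto simp: H_def S_def)
      then show "x \<in> \<pi> ` carrier H" by blast
    qed
  qed
  have component_central: "\<pi> e = \<one>\<^bsub>G\<^esub> \<longleftrightarrow> (\<forall>g\<in>I. e g \<in> group_center (E g))" if e: "e \<in> carrier H" for e
  proof -
    have ec: "e g \<in> carrier (E g)" if "g \<in> I" for g
      using \<pi>_rel[OF e] that by (auto simp: rel_def P_def)
    have "\<pi> e = \<one>\<^bsub>G\<^esub> \<longleftrightarrow> rel e \<one>\<^bsub>G\<^esub>" using \<pi>_rel[OF e] \<pi>[of e] by metis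
    also have "\<dots> \<longleftrightarrow> (\<forall>g\<in>I. \<psi> g (e g) = N g #>\<^bsub>G\<^esub> \<one>\<^bsub>G\<^esub>)"
      using \<pi>_rel[OF e] by (auto simp: rel_def)
    also have "\<dots> \<longleftrightarrow> (\<forall>g\<in>I. e g \<in> kernel (E g) (G Mod N g) (\<psi> g))"
      using ec group_hom.hom_one[OF q] by (auto simp: kernel_def)
    finally show ?thesis using ker by simp
  qed
  have "kernel H G \<pi> = group_center H"
  proof (intro equalityI subsetI)
    fix e assume "e \<in> kernel H G \<pi>"
    then have e: "e \<in> carrier H" "\<And>g. g \<in> I \<Longrightarrow> e g \<in> group_center (E g)"
      using component_central by (auto simp: kernel_def)
    have "e \<otimes>\<^bsub>H\<^esub> f = f \<otimes>\<^bsub>H\<^esub> e" if f: "f \<in> carrier H" for f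
    proof -
      have fc: "f g \<in> carrier (E g)" if "g \<in> I" for g
        using \<pi>_rel[OF f] that by (auto simp: rel_def P_def)
      then show ?thesis using e(2) by (auto simp: H_def P_def group_center_def intro!: restrict_ext)
    qed
    then show "e \<in> group_center H" using e(1) by (simp add: group_center_def)
  next
    fix e assume "e \<in> group_center H"
    then have e: "e \<in> carrier H" and comm: "\<And>f. f \<in> carrier H \<Longrightarrow> e \<otimes>\<^bsub>H\<^esub> f = f \<otimes>\<^bsub>H\<^esub> e"
      by (auto simp: group_center_def)
    have "e g \<in> group_center (E g)" if g: "g \<in> I" for g
    proof -
      have "e g \<otimes>\<^bsub>E g\<^esub> a = a \<otimes>\<^bsub>E g\<^esub> e g" if a: "a \<in> carrier (E g)" for a
      proof -
        have "\<psi> g a \<in> carrier (G Mod N g)" using surj[OF g] a by blast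
        then obtain x where x: "x \<in> carrier G" "\<psi> g a = N g #>\<^bsub>G\<^esub> x"
          by (auto simp: carrier_FactGroup)
        obtain f where f: "rel f x" "f g = a" using lift[OF x(1) g a x(2)] by blast
        then have "f \<in> carrier H" by (auto simp: H_def S_def)
        then have "(e \<otimes>\<^bsub>P\<^esub> f) g = (f \<otimes>\<^bsub>P\<^esub> e) g" using comm by (simp add: H_def)
        then show ?thesis using f g by (simp add: P_def)
      qed
      moreover have "e g \<in> carrier (E g)" using \<pi>_rel[OF e] g by (auto simp: rel_def P_def)
      ultimately show ?thesis by (simp add: group_center_def)
    qed
    then show "e \<in> kernel H G \<pi>" using e component_central by (simp add: kernel_def)
  qed
  then show ?thesis
    using capable_if_kernel_is_center[OF H.is_group G \<pi>_hom \<pi>_surj] by blast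
qed

section \<open>Powers and commutators\<close>

context group
begin

lemma cancel_inv_left:
  assumes "g \<in> carrier G" "h \<in> carrier G"
  shows "inv g \<otimes> (g \<otimes> h) = h" "g \<otimes> (inv g \<otimes> h) = h"
  using assms by (simp_all add: m_assoc[symmetric])

text \<open>Conjugation is an endomorphism, hence commutes with powers.\<close>

lemma conj_int_pow:
  assumes "g \<in> carrier G" "x \<in> carrier G"
  shows "g \<otimes> x [^] (i::int) \<otimes> inv g = (g \<otimes> x \<otimes> inv g) [^] i"
proof -
  have "(\<lambda>x. g \<otimes> x \<otimes> inv g) \<in> hom G G"
    using assms(1) by (intro homI) (simp_all add: m_assoc cancel_inv_left)
  from hom_int_pow[OF this assms(2) is_group is_group] show ?thesis .
qed

lemma commutes_int_pow:
  assumes "x \<otimes> y = y \<otimes> x" "x \<in> carrier G" "y \<in> carrier G"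
  shows "x \<otimes> y [^] (i::int) = y [^] i \<otimes> x"
proof -
  have "x \<otimes> y \<otimes> inv x = y" using assms by (simp add: m_assoc)
  then have "x \<otimes> y [^] i \<otimes> inv x = y [^] i" using conj_int_pow[OF assms(2,3), of i] by simp
  then show ?thesis using assms by (metis int_pow_closed inv_solve_right m_closed)
qed

lemma int_pow_swap_right:
  assumes c: "x \<in> carrier G" "y \<in> carrier G" "z \<in> carrier G"
    and z: "x \<otimes> z = z \<otimes> x" and yx: "y \<otimes> x = x \<otimes> y \<otimes> z" and zy: "y \<otimes> z = z \<otimes> y"
  shows "y \<otimes> x [^] (m::int) = x [^] m \<otimes> y \<otimes> z [^] m"
proof -
  have "y \<otimes> x = (x \<otimes> z) \<otimes> y" using c zy yx by (simp add: m_assoc)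
  then have "y \<otimes> x \<otimes> inv y = x \<otimes> z" using c by (simp add: inv_solve_right')
  then have "y \<otimes> x [^] m \<otimes> inv y = (x \<otimes> z) [^] m" using conj_int_pow[OF c(2,1), of m] by simp
  also have "\<dots> = x [^] m \<otimes> z [^] m" by (rule int_pow_mult_distrib[OF z c(1,3)])
  finally have "y \<otimes> x [^] m = x [^] m \<otimes> z [^] m \<otimes> y"
    using c by (simp add: inv_solve_right')
  then show ?thesis using c commutes_int_pow[OF zy c(2,3), of m] by (simp add: m_assoc)
qed

lemma int_pow_swap_left:
  assumes c: "x \<in> carrier G" "y \<in> carrier G" "z \<in> carrier G"
    and zy: "y \<otimes> z = z \<otimes> y" and yx: "y \<otimes> x = x \<otimes> y \<otimes> z"
  shows "y [^] (a::int) \<otimes> x = x \<otimes> y [^] a \<otimes> z [^] a"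
proof -
  have "inv x \<otimes> y \<otimes> inv (inv x) = y \<otimes> z" using c yx by (simp add: m_assoc inv_solve_left')
  then have "inv x \<otimes> y [^] a \<otimes> x = (y \<otimes> z) [^] a" using conj_int_pow[of "inv x" y a] c by simp
  also have "\<dots> = y [^] a \<otimes> z [^] a" by (rule int_pow_mult_distrib[OF zy c(2,3)])
  finally show ?thesis using c by (simp add: m_assoc inv_solve_left')
qed

text \<open>The commutator map of a group of class two is bilinear, in the form in which it moves powers
  of \<open>y\<close> past powers of \<open>x\<close>. The two lemmas above treat one argument at a time, by conjugating
  with the other; they are combined by applying the first to \<open>y [^] a\<close> and \<open>z [^] a\<close>.\<close>

lemma int_pow_swap:
  assumes c: "x \<in> carrier G" "y \<in> carrier G" "z \<in> carrier G"
    and z: "x \<otimes> z = z \<otimes> x" and zy: "y \<otimes> z = z \<otimes> y" and yx: "y \<otimes> x = x \<otimes> y \<otimes> z"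
  shows "y [^] (a::int) \<otimes> x [^] (m::int) = x [^] m \<otimes> y [^] a \<otimes> z [^] (a * m)"
proof -
  have "y [^] a \<otimes> z [^] a = z [^] a \<otimes> y [^] a"
    using c zy by (metis commutes_int_pow int_pow_closed)
  then show ?thesis
    using int_pow_swap_right[of x "y [^] a" "z [^] a" m] int_pow_swap_left[OF c zy yx, of a]
      commutes_int_pow[OF z] c by (simp add: int_pow_pow)
qed

lemma ord_eq_prime:
  assumes "Factorial_Ring.prime p" "z \<in> carrier G" "z [^] p = \<one>" "z \<noteq> \<one>"
  shows "ord z = p"
proof -
  have "ord z dvd p" using assms by (simp add: pow_eq_id)
  then show ?thesis using assms ord_eq_1[of z] prime_nat_iff by auto
qed

lemma int_pow_mod:
  assumes "x \<in> carrier G" "x [^] (p::nat) = \<one>"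
  shows "x [^] (i mod int p) = x [^] i"
proof -
  have "int (ord x) dvd int p" using assms by (simp add: pow_eq_id)
  then have "int (ord x) dvd i - i mod int p"
    by (metis dvd_trans dvd_minus_mod)
  then show ?thesis using assms int_pow_eq by simp
qed

lemma int_pow_comm: 
  assumes "x \<in> carrier G" "y \<in> carrier G" "x \<otimes> y = y \<otimes> x"
  shows "x [^] (i::int) \<otimes> y [^] (j::int) = y [^] j \<otimes> x [^] i"
proof -
  have "y [^] j \<otimes> x = x \<otimes> y [^] j" using commutes_int_pow[OF assms(3,1,2)] by simp
  then show ?thesis using commutes_int_pow[of "y [^] j" x i] assms(1,2) by simp
qed

end

section \<open>Two model groups\<close>

text \<open>A semidirect product of \<open>F\<^sub>p\<^sup>2\<close> by \<open>C\<^sub>p\<close>: the first coordinate is the exponent \<open>n\<close> of the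
  acting generator, which maps \<open>(a, b)\<close> to \<open>(a, b + a)\<close>. It is the group of unitriangular
  \<open>3 \<times> 3\<close> matrices over \<open>F\<^sub>p\<close>.\<close>

definition heisenberg_mod :: "int \<Rightarrow> (int \<times> int \<times> int) monoid" where
  "heisenberg_mod p = \<lparr>carrier = {0..<p} \<times> {0..<p} \<times> {0..<p},
     monoid.mult = (\<lambda>(n, a, b) (m, a', b'). ((n + m) mod p, (a + a') mod p, (b + b' + m * a) mod p)),
     one = (0, 0, 0)\<rparr>"

text \<open>A semidirect product of \<open>F\<^sub>p\<^sup>3\<close> by \<open>C\<^sub>p\<close> in which the \<open>m\<close>-th power of the acting generator maps
  \<open>(a, b, c)\<close> to \<open>(a, b + m a, c + 2 m b + m\<^sup>2 a)\<close>. This is the exponential of a nilpotent Jordan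
  block, with \<open>c\<close> scaled by two so that the coefficients are integral. Dropping \<open>c\<close> leaves the
  Heisenberg group.\<close>

definition maximal_class_mod :: "int \<Rightarrow> (int \<times> int \<times> int \<times> int) monoid" where
  "maximal_class_mod p = \<lparr>carrier = {0..<p} \<times> {0..<p} \<times> {0..<p} \<times> {0..<p},
     monoid.mult = (\<lambda>(n, a, b, c) (m, a', b', c').
       ((n + m) mod p, (a + a') mod p, (b + b' + m * a) mod p, (c + c' + 2 * m * b + m ^ 2 * a) mod p)),
     one = (0, 0, 0, 0)\<rparr>"

lemma mod_add_mult_right_eq: "(x + m * (y mod p)) mod p = (x + m * y) mod (p::int)"
  by (metis mod_add_right_eq mod_mult_right_eq)

text \<open>These rules remove an inner reduction modulo \<open>p\<close> from the shapes of sums that occur in the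
  group laws, so that associativity and inverses become polynomial identities over the integers.\<close>

lemma mod_product_simps:
  fixes p :: int
  shows "(x + m * (y mod p)) mod p = (x + m * y) mod p"
    and "(x + (y mod p) * m) mod p = (x + y * m) mod p"
    and "(x + m * (y mod p) + z) mod p = (x + m * y + z) mod p"
    and "(x + m * (y mod p) - z) mod p = (x + m * y - z) mod p"
    and "(x + 2 * (y mod p) * m + z) mod p = (x + 2 * y * m + z) mod p"
    and "(x + (y mod p) ^ 2 * m) mod p = (x + y ^ 2 * m) mod p"
    and "(x + y mod p + z) mod p = (x + y + z) mod p"
    and "(x + y mod p + z + w) mod p = (x + y + z + w) mod p"
    and "(y mod p + x + z) mod p = (y + x + z) mod p"
    and "(y mod p + x - z) mod p = (y + x - z) mod p"
    and "(y mod p + x + z + w) mod p = (y + x + z + w) mod p"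
    and "(y mod p + x + z - w) mod p = (y + x + z - w) mod p"
proof -
  have square: "(y mod p) ^ 2 * m mod p = y ^ 2 * m mod p"
    by (metis mod_mult_left_eq power_mod)
  show "(x + (y mod p) ^ 2 * m) mod p = (x + y ^ 2 * m) mod p"
    by (metis square mod_add_right_eq)
  note normalise = add.assoc add.commute add.left_commute mult.assoc mult.commute mult.left_commute diff_conv_add_uminus
  show "(x + m * (y mod p)) mod p = (x + m * y) mod p"
    using mod_add_mult_right_eq[of x m y p] by (simp only: normalise)
  show "(x + (y mod p) * m) mod p = (x + y * m) mod p"
    using mod_add_mult_right_eq[of x m y p] by (simp only: normalise)
  show "(x + m * (y mod p) + z) mod p = (x + m * y + z) mod p"
    using mod_add_mult_right_eq[of "x + z" m y p] by (simp only: normalise)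
  show "(x + m * (y mod p) - z) mod p = (x + m * y - z) mod p"
    using mod_add_mult_right_eq[of "x - z" m y p] by (simp only: normalise)
  show "(x + 2 * (y mod p) * m + z) mod p = (x + 2 * y * m + z) mod p"
    using mod_add_mult_right_eq[of "x + z" "2 * m" y p] by (simp only: normalise)
  show "(x + y mod p + z) mod p = (x + y + z) mod p"
    using mod_add_left_eq[of y p "x + z"] by (simp only: normalise)
  show "(x + y mod p + z + w) mod p = (x + y + z + w) mod p"
    using mod_add_left_eq[of y p "x + z + w"] by (simp only: normalise)
  show "(y mod p + x + z) mod p = (y + x + z) mod p"
    using mod_add_left_eq[of y p "x + z"] by (simp only: normalise)
  show "(y mod p + x - z) mod p = (y + x - z) mod p"
    using mod_add_left_eq[of y p "x - z"] by (simp only: normalise)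
  show "(y mod p + x + z + w) mod p = (y + x + z + w) mod p"
    using mod_add_left_eq[of y p "x + z + w"] by (simp only: normalise)
  show "(y mod p + x + z - w) mod p = (y + x + z - w) mod p"
    using mod_add_left_eq[of y p "x + z - w"] by (simp only: normalise)
qed

lemma group_heisenberg_mod:
  assumes "p > 0" shows "group (heisenberg_mod p)"
proof (rule groupI)
  fix u v w assume "u \<in> carrier (heisenberg_mod p)" "v \<in> carrier (heisenberg_mod p)" "w \<in> carrier (heisenberg_mod p)"
  show "u \<otimes>\<^bsub>heisenberg_mod p\<^esub> v \<otimes>\<^bsub>heisenberg_mod p\<^esub> w = u \<otimes>\<^bsub>heisenberg_mod p\<^esub> (v \<otimes>\<^bsub>heisenberg_mod p\<^esub> w)"
    by (cases u; cases v; cases w) (simp add: heisenberg_mod_def mod_simps mod_product_simps, simp add: algebra_simps)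
next
  fix u assume "u \<in> carrier (heisenberg_mod p)"
  then obtain n a b where u: "u = (n, a, b)" by (cases u) auto
  let ?v = "((- n) mod p, (- a) mod p, (- b + n * a) mod p)"
  have "?v \<in> carrier (heisenberg_mod p)" using assms by (simp add: heisenberg_mod_def)
  moreover have "?v \<otimes>\<^bsub>heisenberg_mod p\<^esub> u = \<one>\<^bsub>heisenberg_mod p\<^esub>"
    by (simp add: u heisenberg_mod_def mod_simps mod_product_simps)
  ultimately show "\<exists>v\<in>carrier (heisenberg_mod p). v \<otimes>\<^bsub>heisenberg_mod p\<^esub> u = \<one>\<^bsub>heisenberg_mod p\<^esub>" by blast
qed (use assms in \<open>auto simp: heisenberg_mod_def\<close>)

lemma group_maximal_class_mod:
  assumes "p > 0" shows "group (maximal_class_mod p)"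
proof (rule groupI)
  fix u v w assume "u \<in> carrier (maximal_class_mod p)" "v \<in> carrier (maximal_class_mod p)" "w \<in> carrier (maximal_class_mod p)"
  show "u \<otimes>\<^bsub>maximal_class_mod p\<^esub> v \<otimes>\<^bsub>maximal_class_mod p\<^esub> w = u \<otimes>\<^bsub>maximal_class_mod p\<^esub> (v \<otimes>\<^bsub>maximal_class_mod p\<^esub> w)"
    by (cases u; cases v; cases w) (simp add: maximal_class_mod_def mod_simps mod_product_simps,
      simp add: algebra_simps power2_eq_square)
next
  fix u assume "u \<in> carrier (maximal_class_mod p)"
  then obtain n a b c where u: "u = (n, a, b, c)" by (cases u) auto
  let ?v = "((- n) mod p, (- a) mod p, (- b + n * a) mod p, (- c + 2 * n * b - n ^ 2 * a) mod p)"
  have "?v \<in> carrier (maximal_class_mod p)" using assms by (simp add: maximal_class_mod_def)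
  moreover have "?v \<otimes>\<^bsub>maximal_class_mod p\<^esub> u = \<one>\<^bsub>maximal_class_mod p\<^esub>"
    by (simp add: u maximal_class_mod_def mod_simps mod_product_simps; simp add: algebra_simps power2_eq_square)
  ultimately show "\<exists>v\<in>carrier (maximal_class_mod p). v \<otimes>\<^bsub>maximal_class_mod p\<^esub> u = \<one>\<^bsub>maximal_class_mod p\<^esub>" by blast
qed (use assms in \<open>auto simp: maximal_class_mod_def\<close>)

lemma residue_eq_0:
  assumes "p dvd a" "0 \<le> a" "a < p" shows "a = (0::int)"
  using assms by (metis dvd_imp_mod_0 mod_pos_pos_trivial)

lemma center_heisenberg_mod:
  assumes "p > 1"
  shows "group_center (heisenberg_mod p) = {0} \<times> {0} \<times> {0..<p}"
proof (intro equalityI subsetI)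
  fix u assume u: "u \<in> group_center (heisenberg_mod p)"
  obtain n a b where u_eq: "u = (n, a, b)" by (cases u) auto
  have r: "0 \<le> n" "n < p" "0 \<le> a" "a < p" "0 \<le> b" "b < p"
    using u by (auto simp: u_eq group_center_def heisenberg_mod_def)
  have c: "u \<otimes>\<^bsub>heisenberg_mod p\<^esub> v = v \<otimes>\<^bsub>heisenberg_mod p\<^esub> u" if "v \<in> carrier (heisenberg_mod p)" for v
    using u that by (simp add: group_center_def)
  have "(b + a) mod p = b mod p" using c[of "(1, 0, 0)"] assms r by (simp add: u_eq heisenberg_mod_def)
  then have "p dvd a" by (simp only: mod_eq_dvd_iff) simp
  moreover have "b mod p = (b + n) mod p" using c[of "(0, 1, 0)"] assms r by (simp add: u_eq heisenberg_mod_def)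
  then have "p dvd n" by (simp only: mod_eq_dvd_iff) simp
  ultimately show "u \<in> {0} \<times> {0} \<times> {0..<p}" using r residue_eq_0 by (auto simp: u_eq)
qed (use assms in \<open>auto simp: group_center_def heisenberg_mod_def add.commute\<close>)

text \<open>Commuting with the acting generator gives \<open>a = 0\<close> and \<open>2 b = 0\<close>; the second equation is
  the one that needs \<open>p\<close> odd.\<close>

lemma center_maximal_class_mod:
  assumes "p > 1" "odd p"
  shows "group_center (maximal_class_mod p) = {0} \<times> {0} \<times> {0} \<times> {0..<p}"
proof (intro equalityI subsetI)
  fix u assume u: "u \<in> group_center (maximal_class_mod p)"
  obtain n a b c where u_eq: "u = (n, a, b, c)" by (cases u) auto
  have r: "0 \<le> n" "n < p" "0 \<le> a" "a < p" "0 \<le> b" "b < p" "0 \<le> c" "c < p"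
    using u by (auto simp: u_eq group_center_def maximal_class_mod_def)
  have comm: "u \<otimes>\<^bsub>maximal_class_mod p\<^esub> v = v \<otimes>\<^bsub>maximal_class_mod p\<^esub> u"
    if "v \<in> carrier (maximal_class_mod p)" for v
    using u that by (simp add: group_center_def)
  have "(b + a) mod p = b mod p" and c2: "(c + 2 * b + a) mod p = c mod p"
    using comm[of "(1, 0, 0, 0)"] assms r by (simp_all add: u_eq maximal_class_mod_def)
  then have "p dvd a" by (simp only: mod_eq_dvd_iff) simp
  have "b mod p = (b + n) mod p" using comm[of "(0, 1, 0, 0)"] assms r
    by (simp add: u_eq maximal_class_mod_def)
  then have "p dvd n" by (simp only: mod_eq_dvd_iff) simp
  have b: "p dvd 2 * b + a" using c2 by (simp only: mod_eq_dvd_iff) (simp add: algebra_simps)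
  have "p dvd 2 * b" using b \<open>p dvd a\<close> by (simp add: dvd_add_left_iff)
  moreover have "coprime p 2" using \<open>odd p\<close> by simp
  ultimately have "p dvd b" by (simp add: coprime_dvd_mult_right_iff)
  then show "u \<in> {0} \<times> {0} \<times> {0} \<times> {0..<p}"
    using r \<open>p dvd a\<close> \<open>p dvd n\<close> residue_eq_0 by (auto simp: u_eq)
qed (use assms in \<open>auto simp: group_center_def maximal_class_mod_def add.commute\<close>)

section \<open>Elementary abelian groups of rank two and Heisenberg groups are capable\<close>

context group
begin

text \<open>A group \<open>C\<^sub>p \<times> C\<^sub>p\<close> with basis \<open>x\<close>, \<open>y\<close> is the image of the Heisenberg group under
  \<open>(n, a, b) \<mapsto> x\<^sup>n y\<^sup>a\<close>, and what is forgotten is the centre.\<close>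

lemma capable_if_two_independent_generators:
  fixes x y :: 'a and p :: nat
  assumes p: "p > 1" and exponent: "\<And>u. u \<in> carrier G \<Longrightarrow> u [^] p = \<one>"
    and c: "x \<in> carrier G" "y \<in> carrier G" and xy: "x \<otimes> y = y \<otimes> x"
    and gen: "\<And>u. u \<in> carrier G \<Longrightarrow> \<exists>(i::int) (j::int). u = x [^] i \<otimes> y [^] j"
    and indep: "\<And>(i::int) (j::int). x [^] i \<otimes> y [^] j = \<one> \<Longrightarrow> int p dvd i \<and> int p dvd j"
  shows "capable G"
proof -
  let ?E = "heisenberg_mod (int p)"
  have E: "group ?E" using p by (simp add: group_heisenberg_mod)
  have center: "group_center ?E = {0} \<times> {0} \<times> {0..<int p}"
    using p by (simp add: center_heisenberg_mod)
  define \<psi> where "\<psi> = (\<lambda>(n::int, a::int, b::int). x [^] n \<otimes> y [^] a)"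
  have red: "u [^] (i mod int p) = u [^] i" if "u \<in> carrier G" for u and i :: int
    by (rule int_pow_mod[OF that exponent[OF that]])
  have "\<psi> \<in> hom ?E G"
  proof (rule homI)
    fix u v assume "u \<in> carrier ?E" "v \<in> carrier ?E"
    obtain n a b where u: "u = (n, a, b)" by (cases u) auto
    obtain m a' b' where v: "v = (m, a', b')" by (cases v) auto
    have "\<psi> (u \<otimes>\<^bsub>?E\<^esub> v) = x [^] n \<otimes> x [^] m \<otimes> (y [^] a \<otimes> y [^] a')"
      using c by (simp add: u v \<psi>_def heisenberg_mod_def red int_pow_mult)
    also have "\<dots> = x [^] n \<otimes> (x [^] m \<otimes> y [^] a) \<otimes> y [^] a'" using c by (simp add: m_assoc)
    also have "x [^] m \<otimes> y [^] a = y [^] a \<otimes> x [^] m" using c xy by (rule int_pow_comm)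
    also have "x [^] n \<otimes> (y [^] a \<otimes> x [^] m) \<otimes> y [^] a' = \<psi> u \<otimes> \<psi> v"
      using c by (simp add: u v \<psi>_def m_assoc)
    finally show "\<psi> (u \<otimes>\<^bsub>?E\<^esub> v) = \<psi> u \<otimes> \<psi> v" .
  qed (use c in \<open>auto simp: \<psi>_def\<close>)
  moreover have "\<psi> ` carrier ?E = carrier G"
  proof
    show "\<psi> ` carrier ?E \<subseteq> carrier G" using c by (auto simp: \<psi>_def)
    show "carrier G \<subseteq> \<psi> ` carrier ?E"
    proof
      fix u assume "u \<in> carrier G"
      then obtain i j :: int where "u = x [^] i \<otimes> y [^] j" using gen by blast
      then have "u = \<psi> (i mod int p, j mod int p, 0)" using c by (simp add: \<psi>_def red)
      moreover have "(i mod int p, j mod int p, 0) \<in> carrier ?E" using p by (simp add: heisenberg_mod_def)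
      ultimately show "u \<in> \<psi> ` carrier ?E" by blast
    qed
  qed
  moreover have "kernel ?E G \<psi> = group_center ?E"
  proof (intro equalityI subsetI)
    fix u assume u: "u \<in> kernel ?E G \<psi>"
    obtain n a b where u_eq: "u = (n, a, b)" by (cases u) auto
    have "int p dvd n" "int p dvd a" using indep[of n a] u by (simp_all add: kernel_def \<psi>_def u_eq)
    moreover have r: "0 \<le> n" "n < int p" "0 \<le> a" "a < int p" "0 \<le> b" "b < int p"
      using u by (simp_all add: u_eq kernel_def heisenberg_mod_def)
    ultimately have "n = 0" "a = 0" using residue_eq_0 by blast+
    then show "u \<in> group_center ?E" using r by (simp add: center u_eq)
  next
    fix u assume "u \<in> group_center ?E"
    then obtain b where "u = (0, 0, b)" "0 \<le> b" "b < int p" unfolding center by auto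
    then show "u \<in> kernel ?E G \<psi>" by (simp add: kernel_def \<psi>_def heisenberg_mod_def)
  qed
  ultimately show ?thesis
    using capable_if_kernel_is_center[OF E is_group] by blast
qed

text \<open>A group with these generators and relations is the Heisenberg group, and every element is
  \<open>x\<^sup>n y\<^sup>a z\<^sup>b\<close>. Forgetting the last coordinate of the group of maximal class is a homomorphism
  onto it, and its kernel is the centre.\<close>

lemma capable_if_heisenberg:
  fixes x y z :: 'a and p :: nat
  assumes p: "Factorial_Ring.prime p" "odd p" and exponent: "\<And>u. u \<in> carrier G \<Longrightarrow> u [^] p = \<one>"
    and c: "x \<in> carrier G" "y \<in> carrier G" "z \<in> carrier G"
    and z: "x \<otimes> z = z \<otimes> x" "y \<otimes> z = z \<otimes> y" "z \<noteq> \<one>" and yx: "y \<otimes> x = x \<otimes> y \<otimes> z"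
    and gen: "generate G {x, y} = carrier G"
  shows "capable G"
proof -
  let ?E = "maximal_class_mod (int p)"
  have p1: "int p > 1" using p prime_gt_1_nat by simp
  interpret E: group ?E by (rule group_maximal_class_mod) (use p1 in simp)
  have center: "group_center ?E = {0} \<times> {0} \<times> {0} \<times> {0..<int p}"
    using p p1 by (simp add: center_maximal_class_mod)
  define \<psi> where "\<psi> = (\<lambda>(n::int, a::int, b::int, c::int). x [^] n \<otimes> y [^] a \<otimes> z [^] b)"
  have red: "u [^] (i mod int p) = u [^] i" if "u \<in> carrier G" for u and i :: int
    by (rule int_pow_mod[OF that exponent[OF that]])
  note swap = int_pow_comm[OF c(3) c(1) z(1)[symmetric]] int_pow_comm[OF c(3) c(2) z(2)[symmetric]]
    int_pow_swap[OF c z(1,2) yx] int_pow_mult[OF c(1), symmetric] int_pow_mult[OF c(2), symmetric]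
    int_pow_mult[OF c(3), symmetric]
  have swap_yx: "y [^] i \<otimes> x [^] j = x [^] j \<otimes> (y [^] i \<otimes> z [^] (i * j))" for i j :: int
    using swap(3) c by (simp add: m_assoc)
  have swap_left: "z [^] i \<otimes> (x [^] j \<otimes> w) = x [^] j \<otimes> (z [^] i \<otimes> w)"
    "z [^] i \<otimes> (y [^] j \<otimes> w) = y [^] j \<otimes> (z [^] i \<otimes> w)"
    "y [^] i \<otimes> (x [^] j \<otimes> w) = x [^] j \<otimes> (y [^] i \<otimes> (z [^] (i * j) \<otimes> w))"
    "x [^] i \<otimes> (x [^] j \<otimes> w) = x [^] (i + j) \<otimes> w"
    "y [^] i \<otimes> (y [^] j \<otimes> w) = y [^] (i + j) \<otimes> w"
    "z [^] i \<otimes> (z [^] j \<otimes> w) = z [^] (i + j) \<otimes> w" if "w \<in> carrier G" for i j :: int and w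
    using c that by (simp_all only: m_assoc[symmetric] int_pow_closed m_closed swap)
  \<comment> \<open>Rewriting with these rules brings every product into the normal form \<open>x\<^sup>n y\<^sup>a z\<^sup>b\<close>.\<close>
  note collect = swap(1,2,4-6) swap_yx swap_left m_assoc
  have hom: "\<psi> \<in> hom ?E G"
  proof (rule homI)
    fix u v assume "u \<in> carrier ?E" "v \<in> carrier ?E"
    obtain n a b d where u: "u = (n, a, b, d)" by (cases u) auto
    obtain m a' b' d' where v: "v = (m, a', b', d')" by (cases v) auto
    have "\<psi> (u \<otimes>\<^bsub>?E\<^esub> v) = x [^] (n + m) \<otimes> (y [^] (a + a') \<otimes> z [^] (b + b' + m * a))"
      using c by (simp add: u v \<psi>_def maximal_class_mod_def red m_assoc)
    also have "\<dots> = \<psi> u \<otimes> \<psi> v"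
      using c by (simp only: u v \<psi>_def prod.case collect int_pow_closed m_closed) (simp add: algebra_simps)
    finally show "\<psi> (u \<otimes>\<^bsub>?E\<^esub> v) = \<psi> u \<otimes> \<psi> v" .
  qed (use c in \<open>auto simp: \<psi>_def\<close>)
  then interpret \<psi>: group_hom ?E G \<psi>
    by (simp add: group_hom_def group_hom_axioms_def is_group E.is_group)
  have "\<psi> ` carrier ?E = carrier G"
  proof
    show "\<psi> ` carrier ?E \<subseteq> carrier G" using \<psi>.hom_closed by blast
    have "x = \<psi> (1, 0, 0, 0)" "y = \<psi> (0, 1, 0, 0)" using c by (simp_all add: \<psi>_def)
    moreover have "(1, 0, 0, 0) \<in> carrier ?E" "(0, 1, 0, 0) \<in> carrier ?E"
      using p1 by (simp_all add: maximal_class_mod_def)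
    ultimately have "{x, y} \<subseteq> \<psi> ` carrier ?E" by blast
    then show "carrier G \<subseteq> \<psi> ` carrier ?E"
      using generate_subgroup_incl[OF _ \<psi>.img_is_subgroup] gen by blast
  qed
  moreover have "kernel ?E G \<psi> = group_center ?E"
  proof (intro equalityI subsetI)
    have z_pow: "int p dvd i" if "z [^] i = \<one>" for i :: int
      using that ord_eq_prime[OF p(1) c(3) exponent[OF c(3)] z(3)] int_pow_eq_id[OF c(3)] by simp
    fix u assume u: "u \<in> kernel ?E G \<psi>"
    obtain n a b d where u_eq: "u = (n, a, b, d)" by (cases u) auto
    have one: "x [^] n \<otimes> y [^] a \<otimes> z [^] b = \<one>" using u by (simp add: kernel_def \<psi>_def u_eq)
    \<comment> \<open>An element mapped to \<open>\<one>\<close> commutes with \<open>y\<close> and with \<open>x\<close>, which kills \<open>z\<^sup>n\<close> and \<open>z\<^sup>a\<close>. The first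
      powers are written as powers to fit the normal form.\<close>
    have "y [^] (1::int) \<otimes> (x [^] n \<otimes> y [^] a \<otimes> z [^] b)
       = (x [^] n \<otimes> y [^] a \<otimes> z [^] b) \<otimes> y [^] (1::int) \<otimes> z [^] n"
      using c by (simp only: collect int_pow_closed m_closed) (simp add: algebra_simps)
    then have "z [^] n = \<one>" using one c by simp
    then have "int p dvd n" by (rule z_pow)
    have "(x [^] n \<otimes> y [^] a \<otimes> z [^] b) \<otimes> x [^] (1::int)
       = x [^] (1::int) \<otimes> (x [^] n \<otimes> y [^] a \<otimes> z [^] b) \<otimes> z [^] a"
      using c by (simp only: collect int_pow_closed m_closed) (simp add: algebra_simps)
    then have "z [^] a = \<one>" using one c by simp
    then have "int p dvd a" by (rule z_pow)
    have r: "0 \<le> n" "n < int p" "0 \<le> a" "a < int p" "0 \<le> b" "b < int p" "0 \<le> d" "d < int p"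
      using u by (simp_all add: u_eq kernel_def maximal_class_mod_def)
    have "n = 0" "a = 0"
      using \<open>int p dvd n\<close> \<open>int p dvd a\<close> r residue_eq_0 by blast+
    moreover from this have "int p dvd b" using one c z_pow by simp
    then have "b = 0" using r residue_eq_0 by blast
    ultimately show "u \<in> group_center ?E" using r by (simp add: center u_eq)
  next
    fix u assume "u \<in> group_center ?E"
    then obtain d where "u = (0, 0, 0, d)" "0 \<le> d" "d < int p" unfolding center by auto
    then show "u \<in> kernel ?E G \<psi>" by (simp add: kernel_def \<psi>_def maximal_class_mod_def)
  qed
  ultimately show ?thesis
    using capable_if_kernel_is_center[OF E.is_group is_group hom] by blast
qed

end

section \<open>Monolithic quotients\<close>

context group
begin

lemma commutes_generate:
  assumes w: "w \<in> carrier G" and S: "S \<subseteq> carrier G" and comm: "\<And>s. s \<in> S \<Longrightarrow> w \<otimes> s = s \<otimes> w"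
    and h: "h \<in> generate G S"
  shows "w \<otimes> h = h \<otimes> w"
proof -
  let ?C = "{x \<in> carrier G. w \<otimes> x = x \<otimes> w}"
  have "subgroup ?C G"
  proof (rule subgroupI)
    show "inv a \<in> ?C" if "a \<in> ?C" for a
      using that w commutes_int_pow[of w a "- 1"] by (simp add: int_pow_neg)
    show "a \<otimes> b \<in> ?C" if ab: "a \<in> ?C" "b \<in> ?C" for a b
    proof -
      have c: "a \<in> carrier G" "b \<in> carrier G" and eq: "w \<otimes> a = a \<otimes> w" "w \<otimes> b = b \<otimes> w"
        using ab by auto
      have "w \<otimes> (a \<otimes> b) = w \<otimes> a \<otimes> b" using w c by (simp add: m_assoc)
      also have "\<dots> = a \<otimes> (w \<otimes> b)" unfolding eq(1) using w c by (simp add: m_assoc)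
      also have "\<dots> = a \<otimes> b \<otimes> w" unfolding eq(2) using w c by (simp add: m_assoc)
      finally show ?thesis using c by simp
    qed
    have "\<one> \<in> ?C" using w by simp
    then show "?C \<noteq> {}" by blast
  qed auto
  moreover have "S \<subseteq> ?C" using S comm by blast
  ultimately show ?thesis using h generate_subgroup_incl by blast
qed

text \<open>Zorn's lemma: a union of a chain of normal subgroups avoiding \<open>g\<close> is again one.\<close>

lemma exists_maximal_normal_avoiding:
  assumes "N0 \<lhd> G" "g \<notin> N0"
  shows "\<exists>N. N \<lhd> G \<and> N0 \<subseteq> N \<and> g \<notin> N \<and> (\<forall>M. M \<lhd> G \<longrightarrow> N \<subseteq> M \<longrightarrow> g \<notin> M \<longrightarrow> M = N)"
proof -
  let ?A = "{N. N \<lhd> G \<and> N0 \<subseteq> N \<and> g \<notin> N}"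
  have "\<exists>N\<in>?A. \<forall>M\<in>?A. N \<subseteq> M \<longrightarrow> M = N"
  proof (rule subset_Zorn_nonempty)
    show "?A \<noteq> {}" using assms by blast
  next
    fix C assume ne: "C \<noteq> {}" and chain: "subset.chain ?A C"
    have normal: "N \<lhd> G" "N0 \<subseteq> N" "g \<notin> N" if "N \<in> C" for N
      using chain that by (auto simp: subset.chain_def)
    have sub: "subgroup N G" if "N \<in> C" for N
      using normal(1)[OF that] by (simp add: normal_inv_iff)
    have "subgroup (\<Union>C) G"
    proof (rule subgroupI)
      show "\<Union>C \<subseteq> carrier G" using subgroup.subset[OF sub] by blast
      obtain N where "N \<in> C" using ne by blast
      then show "\<Union>C \<noteq> {}" using subgroup.one_closed[OF sub] by blast
      show "inv a \<in> \<Union>C" if a: "a \<in> \<Union>C" for a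
      proof -
        obtain N where N: "N \<in> C" "a \<in> N" using a by blast
        then show ?thesis using subgroup.m_inv_closed[OF sub[OF N(1)] N(2)] by blast
      qed
      show "a \<otimes> b \<in> \<Union>C" if ab: "a \<in> \<Union>C" "b \<in> \<Union>C" for a b
      proof -
        obtain M N where MN: "M \<in> C" "a \<in> M" "N \<in> C" "b \<in> N" using ab by blast
        then have "M \<subseteq> N \<or> N \<subseteq> M" using chain by (auto simp: subset.chain_def)
        then show ?thesis
          using MN subgroup.m_closed[OF sub[OF MN(1)], of a b] subgroup.m_closed[OF sub[OF MN(3)], of a b]
          by blast
      qed
    qed
    moreover have "x \<otimes> h \<otimes> inv x \<in> \<Union>C" if x: "x \<in> carrier G" and h: "h \<in> \<Union>C" for x h
    proof -
      obtain N where N: "N \<in> C" "h \<in> N" using h by blast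
      then have "x \<otimes> h \<otimes> inv x \<in> N" using normal(1)[OF N(1)] x by (simp add: normal_inv_iff)
      then show ?thesis using N by blast
    qed
    ultimately have "\<Union>C \<lhd> G" by (simp add: normal_inv_iff)
    moreover have "N0 \<subseteq> \<Union>C" using ne normal(2) by fast
    moreover have "g \<notin> \<Union>C" using normal(3) by fast
    ultimately show "\<Union>C \<in> ?A" by simp
  qed
  then obtain N where N: "N \<in> ?A" "\<forall>M\<in>?A. N \<subseteq> M \<longrightarrow> M = N" by (rule bexE)
  have "M = N" if "M \<lhd> G" "N \<subseteq> M" "g \<notin> M" for M
    using N that by auto
  then show ?thesis using N(1) by auto
qed

text \<open>The element \<open>g\<close> witnesses that the nontrivial normal subgroups have a nontrivial
  intersection, the monolith.\<close>

definition monolithic_at :: "'a \<Rightarrow> bool" where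
  "monolithic_at g \<longleftrightarrow> g \<in> carrier G \<and> g \<noteq> \<one> \<and> (\<forall>M. M \<lhd> G \<longrightarrow> M \<noteq> {\<one>} \<longrightarrow> g \<in> M)"

lemma central_powers_normal:
  assumes z: "z \<in> group_center G"
  shows "range (\<lambda>i::int. z [^] i) \<lhd> G"
proof -
  have zc: "z \<in> carrier G" and comm: "\<And>x. x \<in> carrier G \<Longrightarrow> x \<otimes> z = z \<otimes> x"
    using z by (auto simp: group_center_def)
  have "subgroup (range (\<lambda>i::int. z [^] i)) G"
    using generate_pow[OF zc] generate_is_subgroup[of "{z}"] zc by (simp add: full_SetCompr_eq)
  moreover have "x \<otimes> z [^] i \<otimes> inv x = z [^] i" if x: "x \<in> carrier G" for x and i :: int
    using commutes_int_pow[OF comm[OF x] x zc] x zc by (simp add: m_assoc)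
  ultimately show ?thesis by (auto simp: normal_inv_iff)
qed

text \<open>Every central \<open>c \<noteq> \<one>\<close> generates a normal subgroup of prime order, which contains \<open>g\<close> and is
  therefore also generated by \<open>g\<close>. So the centre, unless trivial, has order \<open>p\<close>.\<close>

lemma monolithic_center:
  fixes p :: nat
  assumes mono: "monolithic_at g" and p: "Factorial_Ring.prime p"
    and exponent: "\<And>u. u \<in> carrier G \<Longrightarrow> u [^] p = \<one>"
    and c: "c \<in> group_center G"
  shows "\<exists>i::int. c = g [^] i"
proof (cases "c = \<one>")
  case True
  then show ?thesis by (intro exI[of _ 0]) simp
next
  case False
  have cc: "c \<in> carrier G" using c by (simp add: group_center_def)
  have "c \<in> range (\<lambda>i::int. c [^] i)" using cc by (intro range_eqI[of _ _ 1]) simp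
  then have "range (\<lambda>i::int. c [^] i) \<noteq> {\<one>}" using False by blast
  then have "g \<in> range (\<lambda>i::int. c [^] i)"
    using mono central_powers_normal[OF c] by (simp add: monolithic_at_def)
  then obtain i :: int where i: "g = c [^] i" by blast
  have "ord c = p" by (rule ord_eq_prime[OF p cc exponent[OF cc] False])
  moreover have "g \<noteq> \<one>" using mono by (simp add: monolithic_at_def)
  ultimately have "\<not> int p dvd i" using i int_pow_eq_id[OF cc] by simp
  then have "coprime (int p) i" using p by (simp add: prime_imp_coprime)
  then obtain u v where "u * int p + v * i = 1" using bezout_int[of "int p" i] by auto
  then have "1 - v * i = u * int p" by simp
  then have "int p dvd 1 - v * i" by simp
  then have "c [^] (i * v) = c [^] (1::int)"
    using int_pow_eq[OF cc] \<open>ord c = p\<close> by (simp add: mult.commute)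
  then show ?thesis using i cc by (intro exI[of _ v]) (simp add: int_pow_pow)
qed

text \<open>The preimage of a normal subgroup of the quotient contains \<open>N\<close>; by maximality it either is
  \<open>N\<close> or contains \<open>g\<close>.\<close>

lemma monolithic_quotient:
  assumes N: "N \<lhd> G" and g: "g \<in> carrier G" "g \<notin> N"
    and max: "\<And>M. M \<lhd> G \<Longrightarrow> N \<subseteq> M \<Longrightarrow> g \<notin> M \<Longrightarrow> M = N"
  shows "group.monolithic_at (G Mod N) (N #> g)"
proof -
  interpret N: normal N G by (rule N)
  interpret q: group_hom G "G Mod N" "\<lambda>x. N #> x" by (rule N.quotient_hom)
  have "N #> g \<in> K" if K: "K \<lhd> G Mod N" "K \<noteq> {N}" for K
  proof (rule ccontr)
    assume not: "N #> g \<notin> K"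
    interpret K: normal K "G Mod N" by (rule K(1))
    define M where "M = {x \<in> carrier G. N #> x \<in> K}"
    have M_mem: "x \<in> M \<longleftrightarrow> N #> x \<in> K" if "x \<in> carrier G" for x
      using that by (simp add: M_def)
    have M_carrier: "x \<in> carrier G" if "x \<in> M" for x using that by (simp add: M_def)
    have "subgroup M G"
    proof (rule subgroupI)
      have "N #> \<one> \<in> K" using K.one_closed unfolding q.hom_one .
      then show "M \<noteq> {}" using M_mem[OF one_closed] by blast
      show "inv a \<in> M" if a: "a \<in> M" for a
      proof -
        have "inv\<^bsub>G Mod N\<^esub> (N #> a) \<in> K" using a M_mem M_carrier K.m_inv_closed by blast
        then show ?thesis using M_mem[OF inv_closed[OF M_carrier[OF a]]] q.hom_inv[OF M_carrier[OF a]] by simp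
      qed
      show "a \<otimes> b \<in> M" if ab: "a \<in> M" "b \<in> M" for a b
      proof -
        have "(N #> a) \<otimes>\<^bsub>G Mod N\<^esub> (N #> b) \<in> K"
          using M_mem M_carrier ab by (intro K.m_closed) blast+
        then show ?thesis 
          using M_mem[OF m_closed] q.hom_mult[of a b] M_carrier[OF ab(1)] M_carrier[OF ab(2)] by simp
      qed
    qed (use M_carrier in blast)
    moreover have "x \<otimes> h \<otimes> inv x \<in> M" if x: "x \<in> carrier G" and h: "h \<in> M" for x h
    proof -
      have hc: "h \<in> carrier G" "N #> h \<in> K" using h by (simp_all add: M_def)
      have "(N #> x) \<otimes>\<^bsub>G Mod N\<^esub> (N #> h) \<otimes>\<^bsub>G Mod N\<^esub> inv\<^bsub>G Mod N\<^esub> (N #> x) \<in> K"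
        by (rule K.inv_op_closed2[OF q.hom_closed[OF x] hc(2)])
      then have "N #> (x \<otimes> h \<otimes> inv x) \<in> K"
        using hc(1) x by (simp only: q.hom_mult q.hom_inv m_closed inv_closed)
      then show ?thesis using x hc(1) by (simp add: M_def)
    qed
    ultimately have "M \<lhd> G" by (simp add: normal_inv_iff)
    moreover have "N \<subseteq> M"
    proof
      fix x assume x: "x \<in> N"
      then have "N #> x = N" using N.coset_eq_self_iff N.mem_carrier by blast
      then show "x \<in> M" using x K.one_closed N.mem_carrier by (simp add: M_def)
    qed
    moreover have "g \<notin> M" using not by (simp add: M_def)
    ultimately have "M = N" by (rule max)
    have "k = N" if k: "k \<in> K" for k
    proof -
      obtain x where x: "x \<in> carrier G" "k = N #> x"
        using K.mem_carrier[OF k] by (auto simp: carrier_FactGroup)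
      then have "x \<in> M" using k by (simp add: M_def)
      then show ?thesis using x \<open>M = N\<close> N.coset_eq_self_iff by simp
    qed
    then have "K \<subseteq> {N}" by blast
    moreover have "N \<in> K" using K.one_closed by (simp only: one_FactGroup)
    ultimately show False using K(2) by blast
  qed
  moreover have "N #> g \<noteq> N" using N.coset_eq_self_iff[OF g(1)] g(2) by blast
  ultimately show ?thesis
    unfolding group.monolithic_at_def[OF N.factorgroup_is_group] one_FactGroup
    using q.hom_closed[OF g(1)] by blast
qed

lemma monolithic_at_nontrivial_power:
  assumes "monolithic_at g" "g [^] (i::int) \<noteq> \<one>"
  shows "monolithic_at (g [^] i)"
  using assms by (auto simp: monolithic_at_def normal_inv_iff intro: subgroup_int_pow_closed)

text \<open>The group is shown to be Heisenberg. Two of the three generators, \<open>x\<close> and \<open>y\<close>, do not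
  commute, and \<open>z\<close>, their commutator, generates the centre. The commutators of the third
  generator \<open>w\<close> with \<open>x\<close> and \<open>y\<close> are powers of \<open>z\<close>, so multiplying \<open>w\<close> by suitable powers of \<open>x\<close>
  and \<open>y\<close> makes it commute with both. The result is central, hence a power of \<open>z\<close>, and \<open>w\<close>
  already lies in the subgroup generated by \<open>x\<close> and \<open>y\<close>.\<close>

lemma capable_if_monolithic_nonabelian:
  fixes p :: nat
  assumes p: "Factorial_Ring.prime p" "odd p" and exponent: "\<And>u. u \<in> carrier G \<Longrightarrow> u [^] p = \<one>"
    and class_2: "\<And>x y. x \<in> carrier G \<Longrightarrow> y \<in> carrier G \<Longrightarrow> x \<otimes> y \<otimes> inv x \<otimes> inv y \<in> group_center G"
    and S: "S \<subseteq> carrier G" "finite S" "card S \<le> 3" "generate G S = carrier G"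
    and mono: "monolithic_at g"
    and nonabelian: "\<exists>x\<in>carrier G. \<exists>y\<in>carrier G. x \<otimes> y \<noteq> y \<otimes> x"
  shows "capable G"
proof -
  have commutator: "\<exists>z\<in>group_center G. y \<otimes> x = x \<otimes> y \<otimes> z" if "x \<in> carrier G" "y \<in> carrier G" for x y
  proof
    show "inv y \<otimes> inv x \<otimes> inv (inv y) \<otimes> inv (inv x) \<in> group_center G"
      using that by (intro class_2) auto
    show "y \<otimes> x = x \<otimes> y \<otimes> (inv y \<otimes> inv x \<otimes> inv (inv y) \<otimes> inv (inv x))"
      using that by (simp add: m_assoc cancel_inv_left)
  qed
  have "\<exists>x\<in>S. \<exists>y\<in>S. x \<otimes> y \<noteq> y \<otimes> x"
  proof (rule ccontr)
    assume "\<not> ?thesis"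
    then have S_comm: "x \<otimes> y = y \<otimes> x" if "x \<in> S" "y \<in> S" for x y using that by blast
    have "x \<otimes> h = h \<otimes> x" if "x \<in> S" "h \<in> carrier G" for x h
      using commutes_generate[of x S h] S_comm that S by blast
    then have "h \<otimes> k = k \<otimes> h" if "h \<in> carrier G" "k \<in> carrier G" for h k
      using commutes_generate[of h S k] that S by (metis subsetD)
    then show False using nonabelian by blast
  qed
  then obtain x y where xy: "x \<in> S" "y \<in> S" "x \<otimes> y \<noteq> y \<otimes> x" by blast
  then have c: "x \<in> carrier G" "y \<in> carrier G" using S by auto
  obtain z where z: "z \<in> group_center G" "y \<otimes> x = x \<otimes> y \<otimes> z" using commutator[OF c] by blast
  have zc: "z \<in> carrier G" and z_comm: "\<And>u. u \<in> carrier G \<Longrightarrow> u \<otimes> z = z \<otimes> u"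
    using z(1) by (auto simp: group_center_def)
  have z1: "z \<noteq> \<one>" using z(2) xy(3) c by auto
  obtain b :: int where "z = g [^] b" using monolithic_center[OF mono p(1) exponent z(1)] by blast
  then have mono_z: "monolithic_at z" using monolithic_at_nontrivial_power[OF mono] z1 by simp
  have center_z: "\<exists>i::int. d = z [^] i" if "d \<in> group_center G" for d
    by (rule monolithic_center[OF mono_z p(1) exponent that])

  define T where "T = generate G {x, y}"
  have T: "subgroup T G" unfolding T_def by (rule generate_is_subgroup) (use c in auto)
  interpret T: subgroup T G by (rule T)
  have xyT: "x \<in> T" "y \<in> T" unfolding T_def by (auto intro: generate.incl)
  have "z = inv (x \<otimes> y) \<otimes> (y \<otimes> x)"
    using c zc z(2) by (simp add: cancel_inv_left)
  then have zT: "z \<in> T" using xyT by simp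

  obtain w where w: "w \<in> carrier G" "S \<subseteq> {x, y, w}"
  proof -
    have "x \<noteq> y" using xy(3) by blast
    then have "card (S - {x, y}) \<le> 1"
      using S(2,3) xy(1,2) by (simp add: card_Diff_subset)
    then have "S - {x, y} = {} \<or> (\<exists>w. S - {x, y} = {w})"
      using S(2) by (metis card_0_eq card_1_singletonE finite_Diff le_Suc_eq le_zero_eq One_nat_def)
    then show ?thesis using that[of x] that c(1) S(1) by blast
  qed
  obtain i j :: int where C: "w \<otimes> x = x \<otimes> w \<otimes> z [^] i" and D: "w \<otimes> y = y \<otimes> w \<otimes> z [^] j"
    using commutator[OF c(1) w(1)] commutator[OF c(2) w(1)] center_z by metis
  \<comment> \<open>The exponents are chosen so that the commutators of \<open>w\<close> with \<open>x\<close> and \<open>y\<close> cancel.\<close>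
  define P where "P = x [^] j"
  define R where "R = y [^] (- i)"
  define w' where "w' = w \<otimes> (P \<otimes> R)"
  have car: "P \<in> carrier G" "R \<in> carrier G" "w' \<in> carrier G" "\<And>k::int. z [^] k \<in> carrier G"
    using c w zc by (auto simp: P_def R_def w'_def)
  have z_pow: "u \<otimes> z [^] (k::int) = z [^] k \<otimes> u" if "u \<in> carrier G" for u k
    by (rule commutes_int_pow[OF z_comm[OF that] that zc])
  have z_cancel: "u \<otimes> z [^] (k::int) \<otimes> v \<otimes> z [^] (- k) = u \<otimes> v" if uv: "u \<in> carrier G" "v \<in> carrier G" for u v k
  proof -
    have "u \<otimes> z [^] k \<otimes> v \<otimes> z [^] (- k) = u \<otimes> (z [^] k \<otimes> v) \<otimes> z [^] (- k)"
      using uv car by (simp add: m_assoc)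
    also have "\<dots> = u \<otimes> v \<otimes> (z [^] k \<otimes> z [^] (- k))"
      unfolding z_pow[OF uv(2), symmetric] using uv car by (simp add: m_assoc)
    also have "\<dots> = u \<otimes> v" using uv zc by (simp add: int_pow_mult[symmetric])
    finally show ?thesis .
  qed
  have "w' \<otimes> x = x \<otimes> w'"
  proof -
    have A: "R \<otimes> x = x \<otimes> R \<otimes> z [^] (- i)"
      unfolding R_def by (rule int_pow_swap_left[OF c zc z_comm[OF c(2)] z(2)])
    have B: "P \<otimes> x = x \<otimes> P" unfolding P_def by (rule commutes_int_pow[OF refl c(1,1), symmetric])
    have "w' \<otimes> x = w \<otimes> P \<otimes> (R \<otimes> x)" using c w car by (simp add: w'_def m_assoc)
    also have "\<dots> = w \<otimes> (P \<otimes> x) \<otimes> R \<otimes> z [^] (- i)" unfolding A using c w car by (simp add: m_assoc)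
    also have "\<dots> = (w \<otimes> x) \<otimes> (P \<otimes> R) \<otimes> z [^] (- i)" unfolding B using c w car by (simp add: m_assoc)
    also have "\<dots> = x \<otimes> w \<otimes> (P \<otimes> R)" unfolding C by (rule z_cancel) (use c w car in auto)
    finally show ?thesis using c w car by (simp add: w'_def m_assoc)
  qed
  moreover have "w' \<otimes> y = y \<otimes> w'"
  proof -
    have "y \<otimes> P = P \<otimes> y \<otimes> z [^] j"
      unfolding P_def by (rule int_pow_swap_right[OF c zc z_comm[OF c(1)] z(2) z_comm[OF c(2)]])
    then have "y \<otimes> P \<otimes> z [^] (- j) = P \<otimes> y \<otimes> z [^] j \<otimes> \<one> \<otimes> z [^] (- j)" using car c by simp
    also have "\<dots> = P \<otimes> y" using z_cancel[of "P \<otimes> y" \<one> j] c car by simp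
    finally have A: "P \<otimes> y = y \<otimes> P \<otimes> z [^] (- j)" by simp
    have B: "R \<otimes> y = y \<otimes> R" unfolding R_def by (rule commutes_int_pow[OF refl c(2,2), symmetric])
    have "w' \<otimes> y = w \<otimes> P \<otimes> (R \<otimes> y)" using c w car by (simp add: w'_def m_assoc)
    also have "\<dots> = w \<otimes> (P \<otimes> y) \<otimes> R" unfolding B using c w car by (simp add: m_assoc)
    also have "\<dots> = (w \<otimes> y) \<otimes> P \<otimes> (z [^] (- j) \<otimes> R)" unfolding A using c w car by (simp add: m_assoc)
    also have "\<dots> = y \<otimes> w \<otimes> z [^] j \<otimes> (P \<otimes> R) \<otimes> z [^] (- j)"
      unfolding D z_pow[OF car(2), symmetric] using c w car by (simp add: m_assoc)
    also have "\<dots> = y \<otimes> w \<otimes> (P \<otimes> R)" by (rule z_cancel) (use c w car in auto)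
    finally show ?thesis using c w car by (simp add: w'_def m_assoc)
  qed
  ultimately have w'_T: "w' \<otimes> t = t \<otimes> w'" if "t \<in> T" for t
    using commutes_generate[of w' "{x, y}" t] c car that by (auto simp: T_def)
  have PR: "P \<otimes> R \<in> T"
    using subgroup_int_pow_closed[OF T] xyT by (simp add: P_def R_def)
  have w_eq: "w = w' \<otimes> inv (P \<otimes> R)" using w car by (simp add: w'_def m_assoc)
  have "w' \<otimes> w = w \<otimes> w'"
  proof -
    have "w' \<otimes> w = w' \<otimes> (w' \<otimes> inv (P \<otimes> R))" using w_eq by simp
    also have "\<dots> = w' \<otimes> (inv (P \<otimes> R) \<otimes> w')" using w'_T[OF T.m_inv_closed[OF PR]] by simp
    also have "\<dots> = w' \<otimes> inv (P \<otimes> R) \<otimes> w'" using car by (simp add: m_assoc)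
    finally show ?thesis using w_eq by simp
  qed
  then have "w' \<otimes> s = s \<otimes> w'" if "s \<in> S" for s using that w(2) w'_T xyT by blast
  then have "w' \<in> group_center G"
    using commutes_generate[OF car(3) S(1)] S(4) car(3) by (simp add: group_center_def)
  then obtain k :: int where "w' = z [^] k" using center_z by blast
  then have "w' \<in> T" using subgroup_int_pow_closed[OF T zT] by simp
  then have "w \<in> T" using w_eq PR by (metis T.m_closed T.m_inv_closed)
  then have "S \<subseteq> T" using w(2) xyT by blast
  then have "generate G {x, y} = carrier G"
    using generate_subgroup_incl[OF _ T] S(4) T.subset unfolding T_def by blast
  then show ?thesis
    using capable_if_heisenberg[OF p exponent c zc z_comm[OF c(1)] z_comm[OF c(2)] z1 z(2)] by blast
qed

end

section \<open>Abelian quotients of rank two\<close>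

context group
begin

lemma subgroup_int_pow_dvd:
  fixes p :: nat
  assumes p: "Factorial_Ring.prime p" and M: "subgroup M G" and u: "u \<in> carrier G" "u \<notin> M" "u [^] p = \<one>"
    and i: "u [^] (i::int) \<in> M"
  shows "int p dvd i"
proof (rule ccontr)
  assume "\<not> int p dvd i"
  then have "coprime (int p) i" using p by (simp add: prime_imp_coprime)
  then obtain a b where ab: "a * int p + b * i = 1" using bezout_int[of "int p" i] by auto
  have "u = u [^] (int p * a + i * b)" using ab u(1) by (simp add: mult.commute)
  also have "\<dots> = (u [^] int p) [^] a \<otimes> (u [^] i) [^] b"
    using u(1) by (simp add: int_pow_mult int_pow_pow)
  also have "\<dots> = (u [^] i) [^] b" using u by (simp add: int_pow_int)
  also have "\<dots> \<in> M" by (rule subgroup_int_pow_closed[OF M i])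
  finally show False using u(2) by simp
qed

lemma quotient_commutes:
  assumes K: "K \<lhd> G" "derived G (carrier G) \<subseteq> K" and c: "x \<in> carrier G" "y \<in> carrier G"
  shows "(K #> x) \<otimes>\<^bsub>G Mod K\<^esub> (K #> y) = (K #> y) \<otimes>\<^bsub>G Mod K\<^esub> (K #> x)"
proof -
  interpret K: normal K G by (rule K(1))
  interpret q: group_hom G "G Mod K" "\<lambda>x. K #> x" by (rule K.quotient_hom)
  have "x \<otimes> y \<otimes> inv x \<otimes> inv y \<in> derived_set G (carrier G)" using c by blast
  then have "x \<otimes> y \<otimes> inv x \<otimes> inv y \<in> K" using K(2) generate.incl[of _ "derived_set G (carrier G)" G]
    unfolding derived_def by blast
  moreover have k: "x \<otimes> y \<otimes> inv x \<otimes> inv y \<in> carrier G" using c by simp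
  ultimately have "K #> (x \<otimes> y \<otimes> inv x \<otimes> inv y) = \<one>\<^bsub>G Mod K\<^esub>"
    unfolding one_FactGroup using K.coset_eq_self_iff by blast
  moreover have yx: "y \<otimes> x \<in> carrier G" using c by simp
  moreover have "x \<otimes> y = (x \<otimes> y \<otimes> inv x \<otimes> inv y) \<otimes> (y \<otimes> x)"
    using c by (simp add: m_assoc cancel_inv_left)
  ultimately have "K #> (x \<otimes> y) = \<one>\<^bsub>G Mod K\<^esub> \<otimes>\<^bsub>G Mod K\<^esub> (K #> (y \<otimes> x))"
    using q.hom_mult[OF k yx] by argo
  also have "\<dots> = K #> (y \<otimes> x)" by (rule q.H.l_one[OF q.hom_closed[OF yx]])
  finally show ?thesis unfolding q.hom_mult[OF c] q.hom_mult[OF c(2,1)] .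
qed

text \<open>The quotient by \<open>N\<close> is abelian, so it equals its centre and is generated by the image of
  \<open>g\<close> by \<open>monolithic_center\<close>.\<close>

lemma powers_cover_maximal_normal:
  fixes p :: nat
  assumes p: "Factorial_Ring.prime p" and exponent: "\<And>u. u \<in> carrier G \<Longrightarrow> u [^] p = \<one>"
    and N: "N \<lhd> G" "derived G (carrier G) \<subseteq> N" and g: "g \<in> carrier G" "g \<notin> N"
    and max: "\<And>M. M \<lhd> G \<Longrightarrow> N \<subseteq> M \<Longrightarrow> g \<notin> M \<Longrightarrow> M = N"
    and h: "h \<in> carrier G"
  shows "\<exists>i::int. inv (g [^] i) \<otimes> h \<in> N"
proof -
  interpret N: normal N G by (rule N(1))
  interpret q: group_hom G "G Mod N" "\<lambda>x. N #> x" by (rule N.quotient_hom)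
  have exponent_Q: "u [^]\<^bsub>G Mod N\<^esub> p = \<one>\<^bsub>G Mod N\<^esub>" if u: "u \<in> carrier (G Mod N)" for u
  proof -
    obtain x where "x \<in> carrier G" "u = N #> x" using u by (auto simp: carrier_FactGroup)
    then show ?thesis using q.hom_nat_pow[of x p] exponent q.hom_one by simp
  qed
  have center: "N #> h \<in> group_center (G Mod N)"
  proof -
    have "(N #> h) \<otimes>\<^bsub>G Mod N\<^esub> u = u \<otimes>\<^bsub>G Mod N\<^esub> (N #> h)" if u: "u \<in> carrier (G Mod N)" for u
    proof -
      obtain x where x: "x \<in> carrier G" "u = N #> x" using u by (auto simp: carrier_FactGroup)
      show ?thesis unfolding x(2) by (rule quotient_commutes[OF N h x(1)])
    qed
    then show ?thesis using q.hom_closed[OF h] unfolding group_center_def by blast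
  qed
  have mono: "group.monolithic_at (G Mod N) (N #> g)"
    by (rule monolithic_quotient[OF N(1) g max])
  have "\<exists>i::int. N #> h = (N #> g) [^]\<^bsub>G Mod N\<^esub> i"
    by (rule group.monolithic_center[OF N.factorgroup_is_group mono p exponent_Q center])
  then obtain i :: int where i: "N #> h = (N #> g) [^]\<^bsub>G Mod N\<^esub> i" by (rule exE)
  have gi: "g [^] i \<in> carrier G" "inv (g [^] i) \<in> carrier G" using g(1) by simp_all
  have "N #> (inv (g [^] i) \<otimes> h) = (N #> inv (g [^] i)) \<otimes>\<^bsub>G Mod N\<^esub> (N #> h)"
    by (rule q.hom_mult[OF gi(2) h])
  also have "N #> inv (g [^] i) = inv\<^bsub>G Mod N\<^esub> (N #> h)"
    unfolding q.hom_inv[OF gi(1)] i q.hom_int_pow[OF g(1)] ..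
  also have "inv\<^bsub>G Mod N\<^esub> (N #> h) \<otimes>\<^bsub>G Mod N\<^esub> (N #> h) = N"
    using q.H.l_inv[OF q.hom_closed[OF h]] unfolding one_FactGroup .
  finally have "inv (g [^] i) \<otimes> h \<in> N"
    using N.coset_eq_self_iff[OF m_closed[OF gi(2) h]] by blast
  then show ?thesis by (rule exI)
qed

text \<open>If \<open>G = \<langle>g\<rangle> G'\<close> and \<open>G'\<close> is central, then \<open>g\<close> is central, so \<open>G\<close> is abelian, \<open>G'\<close> is
  trivial and \<open>G = \<langle>g\<rangle>\<close>.\<close>

lemma cyclic_if_generated_modulo_derived:
  assumes g: "g \<in> carrier G" and class_2: "derived G (carrier G) \<subseteq> group_center G"
    and cover: "\<And>h. h \<in> carrier G \<Longrightarrow> \<exists>i::int. inv (g [^] i) \<otimes> h \<in> derived G (carrier G)"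
  shows "cyclic_group G"
proof -
  interpret Z: normal "group_center G" G by (rule group_center_normal) (rule is_group)
  have split: "\<exists>(i::int) d. d \<in> derived G (carrier G) \<and> d \<in> group_center G \<and> h = g [^] i \<otimes> d"
    if h: "h \<in> carrier G" for h
  proof -
    obtain i :: int where i: "inv (g [^] i) \<otimes> h \<in> derived G (carrier G)" using cover[OF h] by blast
    let ?d = "inv (g [^] i) \<otimes> h"
    have "?d \<in> group_center G" using class_2 i by (rule subsetD)
    moreover have "h = g [^] i \<otimes> ?d" using g h by (simp add: cancel_inv_left)
    ultimately have "?d \<in> derived G (carrier G) \<and> ?d \<in> group_center G \<and> h = g [^] i \<otimes> ?d"
      using i by blast
    then show ?thesis by blast
  qed
  have "g \<otimes> h = h \<otimes> g" if h: "h \<in> carrier G" for h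
  proof -
    obtain i :: int and d where d: "d \<in> group_center G" "h = g [^] i \<otimes> d"
      using split[OF h] by metis
    have dc: "d \<in> carrier G" "d \<otimes> g = g \<otimes> d"
      using d(1) g unfolding group_center_def by blast+
    have "g \<otimes> h = (g \<otimes> g [^] i) \<otimes> d" unfolding d(2) using g dc(1) by (simp add: m_assoc)
    also have "g \<otimes> g [^] i = g [^] i \<otimes> g" by (rule commutes_int_pow[OF refl g g])
    also have "g [^] i \<otimes> g \<otimes> d = g [^] i \<otimes> (g \<otimes> d)" using g dc(1) by (simp add: m_assoc)
    also have "g \<otimes> d = d \<otimes> g" by (rule dc(2)[symmetric])
    also have "g [^] i \<otimes> (d \<otimes> g) = h \<otimes> g" unfolding d(2) using g dc(1) by (simp add: m_assoc)
    finally show ?thesis .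
  qed
  then have "g \<in> group_center G" using g unfolding group_center_def by blast
  then have power_central: "g [^] i \<in> group_center G" for i :: int
    by (rule subgroup_int_pow_closed[OF Z.subgroup_axioms])
  have "h \<in> group_center G" if h: "h \<in> carrier G" for h
  proof -
    obtain i :: int and d where "d \<in> group_center G" "h = g [^] i \<otimes> d"
      using split[OF h] by metis
    then show ?thesis using Z.m_closed[OF power_central] by simp
  qed
  then have comm: "x \<otimes> y = y \<otimes> x" if "x \<in> carrier G" "y \<in> carrier G" for x y
    using that unfolding group_center_def by blast
  have "comm_group G" by (rule group_comm_groupI) (rule comm)
  then have derived: "derived G (carrier G) = {\<one>}"
    by (rule comm_group.derived_eq_singleton) simp
  have "carrier G \<subseteq> range (\<lambda>i::int. g [^] i)"
  proof
    fix h assume "h \<in> carrier G"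
    then obtain i :: int and d where "d \<in> derived G (carrier G)" "h = g [^] i \<otimes> d"
      using split by blast
    then have "h = g [^] i" using derived g by simp
    then show "h \<in> range (\<lambda>i::int. g [^] i)" by (rule range_eqI)
  qed
  then have "carrier G = range (\<lambda>i::int. g [^] i)" using g by auto
  then show ?thesis unfolding cyclic_group using g by (rule bexI)
qed

text \<open>A second normal subgroup \<open>M\<close> of index \<open>p\<close> is obtained by avoiding some \<open>u \<in> N\<close> outside
  the derived subgroup. Then \<open>g = u\<^sup>k v\<close> with \<open>v \<in> M\<close>, and \<open>u\<close>, \<open>v\<close> form a basis of the quotient by
  \<open>K = N \<inter> M\<close>, since \<open>u\<close> vanishes modulo \<open>N\<close> and \<open>v\<close> modulo \<open>M\<close>.\<close>

lemma exists_rank_two_abelian_quotient: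
  fixes p :: nat
  assumes p: "Factorial_Ring.prime p" and exponent: "\<And>u. u \<in> carrier G \<Longrightarrow> u [^] p = \<one>"
    and class_2: "derived G (carrier G) \<subseteq> group_center G" and not_cyclic: "\<not> cyclic_group G"
    and N: "N \<lhd> G" "derived G (carrier G) \<subseteq> N" and g: "g \<in> carrier G" "g \<notin> N"
    and max: "\<And>M. M \<lhd> G \<Longrightarrow> N \<subseteq> M \<Longrightarrow> g \<notin> M \<Longrightarrow> M = N"
  shows "\<exists>K. K \<lhd> G \<and> g \<notin> K \<and> capable (G Mod K)"
proof -
  let ?D = "derived G (carrier G)"
  interpret N: normal N G by (rule N(1))
  have D: "?D \<lhd> G"
    by (rule derived_is_normal) (simp add: normal_inv_iff subgroup_self)
  have "N \<noteq> ?D"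
    using cyclic_if_generated_modulo_derived[OF g(1) class_2] not_cyclic
      powers_cover_maximal_normal[OF p exponent N g max] by blast
  then obtain u where u: "u \<in> N" "u \<notin> ?D" using N(2) by blast
  have uc: "u \<in> carrier G" using u(1) by (rule N.mem_carrier)
  obtain M where M: "M \<lhd> G" "?D \<subseteq> M" "u \<notin> M"
    and M_max: "\<And>L. L \<lhd> G \<Longrightarrow> M \<subseteq> L \<Longrightarrow> u \<notin> L \<Longrightarrow> L = M"
    using exists_maximal_normal_avoiding[OF D u(2)] by blast
  interpret M: normal M G by (rule M(1))
  obtain k :: int where k: "inv (u [^] k) \<otimes> g \<in> M"
    using powers_cover_maximal_normal[OF p exponent M(1,2) uc M(3) M_max g(1)] by blast
  define v where "v = inv (u [^] k) \<otimes> g"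
  have v: "v \<in> M" "v \<in> carrier G" using k uc g(1) by (simp_all add: v_def)
  have g_eq: "g = u [^] k \<otimes> v" using uc g(1) by (simp add: v_def cancel_inv_left)
  have uk: "u [^] k \<in> N" by (rule subgroup_int_pow_closed[OF N.subgroup_axioms u(1)])
  \<comment> \<open>\<open>N\<close> is also maximal among the normal subgroups avoiding \<open>v\<close>, as \<open>g\<close> and \<open>v\<close> agree up to an element of \<open>N\<close>.\<close>
  have avoid_v: "g \<notin> L" if "subgroup L G" "N \<subseteq> L" "v \<notin> L" for L
  proof
    assume "g \<in> L"
    interpret L: subgroup L G by (rule that(1))
    have "u [^] k \<in> L" using uk that(2) by blast
    then show False using L.m_closed[OF L.m_inv_closed \<open>g \<in> L\<close>] that(3) by (simp add: v_def)
  qed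
  have vN: "v \<notin> N"
  proof
    assume "v \<in> N"
    then show False using uk g_eq g(2) N.m_closed by metis
  qed
  have v_max: "L = N" if L: "L \<lhd> G" "N \<subseteq> L" "v \<notin> L" for L
    using max[OF L(1,2)] avoid_v[OF _ L(2,3)] L(1) by (simp add: normal_inv_iff)
  define K where "K = N \<inter> M"
  have K: "K \<lhd> G"
    using N(1) M(1) subgroups_Inter_pair[of N M] by (simp add: K_def normal_inv_iff)
  interpret K: normal K G by (rule K)
  interpret q: group_hom G "G Mod K" "\<lambda>x. K #> x" by (rule K.quotient_hom)
  have "capable (G Mod K)"
  proof (rule group.capable_if_two_independent_generators[OF K.factorgroup_is_group])
    show "p > 1" using p prime_gt_1_nat by blast
    show "K #> u \<in> carrier (G Mod K)" "K #> v \<in> carrier (G Mod K)"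
      using uc v(2) by (auto intro: q.hom_closed)
    show "(K #> u) \<otimes>\<^bsub>G Mod K\<^esub> (K #> v) = (K #> v) \<otimes>\<^bsub>G Mod K\<^esub> (K #> u)"
      by (rule quotient_commutes[OF K _ uc v(2)]) (use N(2) M(2) in \<open>auto simp: K_def\<close>)
    show "x [^]\<^bsub>G Mod K\<^esub> p = \<one>\<^bsub>G Mod K\<^esub>" if x: "x \<in> carrier (G Mod K)" for x
    proof -
      obtain h where "h \<in> carrier G" "x = K #> h" using x by (auto simp: carrier_FactGroup)
      then show ?thesis using q.hom_nat_pow[of h p] exponent q.hom_one by simp
    qed
    have image: "(K #> u) [^]\<^bsub>G Mod K\<^esub> i \<otimes>\<^bsub>G Mod K\<^esub> (K #> v) [^]\<^bsub>G Mod K\<^esub> j = K #> (u [^] i \<otimes> v [^] j)"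
      for i j :: int
      using q.hom_int_pow[OF uc, of i] q.hom_int_pow[OF v(2), of j]
        q.hom_mult[OF int_pow_closed[OF uc] int_pow_closed[OF v(2)], of i j] by simp
    show "\<exists>(i::int) (j::int). x = (K #> u) [^]\<^bsub>G Mod K\<^esub> i \<otimes>\<^bsub>G Mod K\<^esub> (K #> v) [^]\<^bsub>G Mod K\<^esub> j"
      if x: "x \<in> carrier (G Mod K)" for x
    proof -
      obtain h where h: "h \<in> carrier G" "x = K #> h" using x by (auto simp: carrier_FactGroup)
      obtain i :: int where i: "inv (u [^] i) \<otimes> h \<in> M"
        using powers_cover_maximal_normal[OF p exponent M(1,2) uc M(3) M_max h(1)] by blast
      obtain j :: int where j: "inv (v [^] j) \<otimes> (inv (u [^] i) \<otimes> h) \<in> N"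
        using powers_cover_maximal_normal[OF p exponent N v(2) vN v_max M.mem_carrier[OF i]] by blast
      define d where "d = inv (v [^] j) \<otimes> (inv (u [^] i) \<otimes> h)"
      have "v [^] j \<in> M" by (rule subgroup_int_pow_closed[OF M.subgroup_axioms v(1)])
      then have d: "d \<in> K" unfolding K_def using i j by (simp add: d_def)
      have "h = (u [^] i \<otimes> v [^] j) \<otimes> d"
        using uc v(2) h(1) by (simp add: d_def m_assoc cancel_inv_left)
      moreover have uv: "u [^] i \<otimes> v [^] j \<in> carrier G" using uc v(2) by simp
      ultimately have "x = (K #> (u [^] i \<otimes> v [^] j)) \<otimes>\<^bsub>G Mod K\<^esub> (K #> d)"
        unfolding h(2) using q.hom_mult[OF uv K.mem_carrier[OF d]] by argo
      also have "K #> d = \<one>\<^bsub>G Mod K\<^esub>"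
        unfolding one_FactGroup using d K.coset_eq_self_iff[OF K.mem_carrier[OF d]] by blast
      also have "(K #> (u [^] i \<otimes> v [^] j)) \<otimes>\<^bsub>G Mod K\<^esub> \<one>\<^bsub>G Mod K\<^esub> = K #> (u [^] i \<otimes> v [^] j)"
        by (rule q.H.r_one[OF q.hom_closed[OF uv]])
      also have "\<dots> = (K #> u) [^]\<^bsub>G Mod K\<^esub> i \<otimes>\<^bsub>G Mod K\<^esub> (K #> v) [^]\<^bsub>G Mod K\<^esub> j"
        by (rule image[symmetric])
      finally show ?thesis by blast
    qed
    show "int p dvd i \<and> int p dvd j"
      if eq: "(K #> u) [^]\<^bsub>G Mod K\<^esub> i \<otimes>\<^bsub>G Mod K\<^esub> (K #> v) [^]\<^bsub>G Mod K\<^esub> j = \<one>\<^bsub>G Mod K\<^esub>" for i j :: int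
    proof -
      have pow: "u [^] i \<in> carrier G" "v [^] j \<in> carrier G" using uc v(2) by simp_all
      have K_mem: "u [^] i \<otimes> v [^] j \<in> K"
        using eq K.coset_eq_self_iff[OF m_closed[OF pow]] unfolding image one_FactGroup by blast
      have uN: "u [^] i \<in> N" by (rule subgroup_int_pow_closed[OF N.subgroup_axioms u(1)])
      have vM: "v [^] j \<in> M" by (rule subgroup_int_pow_closed[OF M.subgroup_axioms v(1)])
      have "u [^] i = (u [^] i \<otimes> v [^] j) \<otimes> inv (v [^] j)" using pow by (simp add: m_assoc)
      moreover have "\<dots> \<in> M" 
        by (rule M.m_closed[OF _ M.m_inv_closed[OF vM]]) (use K_mem in \<open>simp add: K_def\<close>)
      ultimately have uM: "u [^] i \<in> M" by argo
      have "v [^] j = inv (u [^] i) \<otimes> (u [^] i \<otimes> v [^] j)" using pow by (simp add: cancel_inv_left)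
      moreover have "\<dots> \<in> N" 
        by (rule N.m_closed[OF N.m_inv_closed[OF uN]]) (use K_mem in \<open>simp add: K_def\<close>)
      ultimately have "v [^] j \<in> N" by argo
      with uM show ?thesis
        using subgroup_int_pow_dvd[OF p M.subgroup_axioms uc M(3) exponent[OF uc]]
          subgroup_int_pow_dvd[OF p N.subgroup_axioms v(2) vN exponent[OF v(2)]] by blast
    qed
  qed
  then show ?thesis using K g(2) by (auto simp: K_def)
qed

end

section \<open>Three-generated groups of class two and exponent \<open>p\<close>\<close>

lemma class_at_most_2_derived_central:
  assumes "group G" "class_at_most G 2"
  shows "derived G (carrier G) \<subseteq> group_center G"
proof -
  interpret group G by fact
  interpret Z: normal "group_center G" G by (rule group_center_normal) fact
  have "x \<otimes>\<^bsub>G\<^esub> y \<otimes>\<^bsub>G\<^esub> inv\<^bsub>G\<^esub> x \<otimes>\<^bsub>G\<^esub> inv\<^bsub>G\<^esub> y \<in> group_center G"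
    if c: "x \<in> carrier G" "y \<in> carrier G" for x y
  proof -
    let ?k = "x \<otimes>\<^bsub>G\<^esub> y \<otimes>\<^bsub>G\<^esub> inv\<^bsub>G\<^esub> x \<otimes>\<^bsub>G\<^esub> inv\<^bsub>G\<^esub> y"
    have k: "?k \<in> lower_central G 1" "?k \<in> carrier G"
      using c by (auto simp: commutator_subgroup_def intro!: generate.incl)
    have "?k \<otimes>\<^bsub>G\<^esub> w = w \<otimes>\<^bsub>G\<^esub> ?k" if w: "w \<in> carrier G" for w
    proof -
      let ?l = "?k \<otimes>\<^bsub>G\<^esub> w \<otimes>\<^bsub>G\<^esub> inv\<^bsub>G\<^esub> ?k \<otimes>\<^bsub>G\<^esub> inv\<^bsub>G\<^esub> w"
      have "?l \<in> lower_central G (Suc 1)"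
        unfolding lower_central.simps(2)[of G 1] commutator_subgroup_def
        by (rule generate.incl, rule CollectI, rule exI[of _ ?k], rule exI[of _ w], intro conjI refl k(1) w)
      moreover have "lower_central G (Suc 1) = {\<one>\<^bsub>G\<^esub>}"
        using assms(2) by (simp only: class_at_most_def numeral_2_eq_2 One_nat_def)
      ultimately have l: "?l = \<one>\<^bsub>G\<^esub>" by blast
      have one: "?l \<otimes>\<^bsub>G\<^esub> (w \<otimes>\<^bsub>G\<^esub> ?k) = w \<otimes>\<^bsub>G\<^esub> ?k"
        unfolding l by (rule l_one[OF m_closed[OF w k(2)]])
      have swap: "t \<otimes>\<^bsub>G\<^esub> w \<otimes>\<^bsub>G\<^esub> inv\<^bsub>G\<^esub> t \<otimes>\<^bsub>G\<^esub> inv\<^bsub>G\<^esub> w \<otimes>\<^bsub>G\<^esub> (w \<otimes>\<^bsub>G\<^esub> t) = t \<otimes>\<^bsub>G\<^esub> w"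
        if "t \<in> carrier G" for t
        using that w by (simp add: m_assoc cancel_inv_left)
      show ?thesis using one unfolding swap[OF k(2)] .
    qed
    then show ?thesis using k(2) unfolding group_center_def by blast
  qed
  then have "derived_set G (carrier G) \<subseteq> group_center G" by blast
  then show ?thesis unfolding derived_def by (rule generate_subgroup_incl[OF _ Z.subgroup_axioms])
qed

theorem theorem5p11:
  fixes p :: nat and G :: "('a, 'b) monoid_scheme"
  assumes "Factorial_Ring.prime p" and "odd p"
    and "group G"
    and "n_generated G 3"
    and "class_at_most G 2"
    and "has_exponent G p"
  shows "cyclic_group G \<or> capable G"
proof (cases "cyclic_group G")
  case not_cyclic: False
  interpret group G by fact
  obtain S where S: "S \<subseteq> carrier G" "finite S" "card S \<le> 3" "generate G S = carrier G"
    using assms(4) by (auto simp: n_generated_def)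
  have exponent: "u [^]\<^bsub>G\<^esub> p = \<one>\<^bsub>G\<^esub>" if "u \<in> carrier G" for u
    using assms(6) that by (simp add: has_exponent_def)
  have class_2: "derived G (carrier G) \<subseteq> group_center G"
    by (rule class_at_most_2_derived_central) fact+
  have "\<exists>K. K \<lhd> G \<and> g \<notin> K \<and> capable (G Mod K)" if g: "g \<in> carrier G" "g \<noteq> \<one>\<^bsub>G\<^esub>" for g
  proof -
    have "{\<one>\<^bsub>G\<^esub>} \<lhd> G" by (rule one_is_normal)
    then obtain N where N: "N \<lhd> G" "g \<notin> N"
      and max: "\<And>M. M \<lhd> G \<Longrightarrow> N \<subseteq> M \<Longrightarrow> g \<notin> M \<Longrightarrow> M = N"
      using exists_maximal_normal_avoiding[of "{\<one>\<^bsub>G\<^esub>}" g] g(2) by blast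
    interpret N: normal N G by (rule N(1))
    interpret q: group_hom G "G Mod N" "\<lambda>x. N #>\<^bsub>G\<^esub> x" by (rule N.quotient_hom)
    let ?Q = "G Mod N"
    show ?thesis
    proof (cases "\<exists>x\<in>carrier ?Q. \<exists>y\<in>carrier ?Q. x \<otimes>\<^bsub>?Q\<^esub> y \<noteq> y \<otimes>\<^bsub>?Q\<^esub> x")
      case nonabelian: True
      have lift: "\<exists>h\<in>carrier G. x = N #>\<^bsub>G\<^esub> h" if "x \<in> carrier ?Q" for x
        using that by (auto simp: carrier_FactGroup)
      have "capable ?Q"
      proof (rule group.capable_if_monolithic_nonabelian[OF N.factorgroup_is_group assms(1,2)])
        show "group.monolithic_at ?Q (N #>\<^bsub>G\<^esub> g)"
          by (rule monolithic_quotient[OF N(1) g(1) N(2) max])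
        show "x [^]\<^bsub>?Q\<^esub> p = \<one>\<^bsub>?Q\<^esub>" if x: "x \<in> carrier ?Q" for x
        proof -
          obtain h where "h \<in> carrier G" "x = N #>\<^bsub>G\<^esub> h" using lift[OF x] by blast
          then show ?thesis using q.hom_nat_pow[of h p] exponent q.hom_one by simp
        qed
        show "(\<lambda>x. N #>\<^bsub>G\<^esub> x) ` S \<subseteq> carrier ?Q" using S(1) q.hom_closed by blast
        show "finite ((\<lambda>x. N #>\<^bsub>G\<^esub> x) ` S)" using S(2) by simp
        show "card ((\<lambda>x. N #>\<^bsub>G\<^esub> x) ` S) \<le> 3" using card_image_le[OF S(2)] S(3) le_trans by blast
        show "generate ?Q ((\<lambda>x. N #>\<^bsub>G\<^esub> x) ` S) = carrier ?Q"
          using q.generate_img[OF S(1)] S(4) by (simp add: carrier_FactGroup)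
        show "x \<otimes>\<^bsub>?Q\<^esub> y \<otimes>\<^bsub>?Q\<^esub> inv\<^bsub>?Q\<^esub> x \<otimes>\<^bsub>?Q\<^esub> inv\<^bsub>?Q\<^esub> y \<in> group_center ?Q"
          if xy: "x \<in> carrier ?Q" "y \<in> carrier ?Q" for x y
        proof -
          obtain a where a: "a \<in> carrier G" "x = N #>\<^bsub>G\<^esub> a" using lift[OF xy(1)] by blast
          obtain b where b: "b \<in> carrier G" "y = N #>\<^bsub>G\<^esub> b" using lift[OF xy(2)] by blast
          let ?k = "a \<otimes>\<^bsub>G\<^esub> b \<otimes>\<^bsub>G\<^esub> inv\<^bsub>G\<^esub> a \<otimes>\<^bsub>G\<^esub> inv\<^bsub>G\<^esub> b"
          have "?k \<in> derived_set G (carrier G)" using a(1) b(1) by blast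
          then have "?k \<in> derived G (carrier G)" unfolding derived_def by (rule generate.incl)
          then have k: "?k \<in> group_center G" using class_2 by blast
          have kc: "?k \<in> carrier G" using a(1) b(1) by simp
          have eq: "x \<otimes>\<^bsub>?Q\<^esub> y \<otimes>\<^bsub>?Q\<^esub> inv\<^bsub>?Q\<^esub> x \<otimes>\<^bsub>?Q\<^esub> inv\<^bsub>?Q\<^esub> y = N #>\<^bsub>G\<^esub> ?k"
            unfolding a(2) b(2) using a(1) b(1)
            by (simp only: q.hom_mult q.hom_inv m_closed inv_closed)
          have "(N #>\<^bsub>G\<^esub> ?k) \<otimes>\<^bsub>?Q\<^esub> u = u \<otimes>\<^bsub>?Q\<^esub> (N #>\<^bsub>G\<^esub> ?k)" if u: "u \<in> carrier ?Q" for u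
          proof -
            obtain c where c: "c \<in> carrier G" "u = N #>\<^bsub>G\<^esub> c" using lift[OF u] by blast
            have "?k \<otimes>\<^bsub>G\<^esub> c = c \<otimes>\<^bsub>G\<^esub> ?k" using k c(1) by (simp add: group_center_def)
            then show ?thesis unfolding c(2) q.hom_mult[OF kc c(1), symmetric] q.hom_mult[OF c(1) kc, symmetric]
              by (rule arg_cong)
          qed
          then show ?thesis unfolding eq using q.hom_closed[OF kc] unfolding group_center_def by blast
        qed
      qed (rule nonabelian)
      then show ?thesis using N by blast
    next
      \<comment> \<open>Here the quotient is only cyclic of order \<open>p\<close>, hence not capable itself; but \<open>N\<close> contains the
      derived subgroup.\<close>
      case False
      then have "comm_group ?Q" by (intro group.group_comm_groupI[OF N.factorgroup_is_group]) blast
      then interpret Q: comm_group ?Q .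
      have "a \<otimes>\<^bsub>G\<^esub> b \<otimes>\<^bsub>G\<^esub> inv\<^bsub>G\<^esub> a \<otimes>\<^bsub>G\<^esub> inv\<^bsub>G\<^esub> b \<in> N"
        if ab: "a \<in> carrier G" "b \<in> carrier G" for a b
      proof -
        let ?k = "a \<otimes>\<^bsub>G\<^esub> b \<otimes>\<^bsub>G\<^esub> inv\<^bsub>G\<^esub> a \<otimes>\<^bsub>G\<^esub> inv\<^bsub>G\<^esub> b"
        have ab': "a \<otimes>\<^bsub>G\<^esub> b \<in> carrier G" "b \<otimes>\<^bsub>G\<^esub> a \<in> carrier G" using ab by simp_all
        have eq: "N #>\<^bsub>G\<^esub> (a \<otimes>\<^bsub>G\<^esub> b) = N #>\<^bsub>G\<^esub> (b \<otimes>\<^bsub>G\<^esub> a)"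
          unfolding q.hom_mult[OF ab] q.hom_mult[OF ab(2,1)]
          by (rule Q.m_comm) (use ab q.hom_closed in blast)+
        have "?k = (a \<otimes>\<^bsub>G\<^esub> b) \<otimes>\<^bsub>G\<^esub> inv\<^bsub>G\<^esub> (b \<otimes>\<^bsub>G\<^esub> a)"
          using ab by (simp add: inv_mult_group m_assoc)
        moreover have "?k \<in> carrier G" using ab by simp
        ultimately have "?k \<in> carrier G" "N #>\<^bsub>G\<^esub> ?k = (N #>\<^bsub>G\<^esub> (b \<otimes>\<^bsub>G\<^esub> a)) \<otimes>\<^bsub>?Q\<^esub> inv\<^bsub>?Q\<^esub> (N #>\<^bsub>G\<^esub> (b \<otimes>\<^bsub>G\<^esub> a))"
          using q.hom_mult[OF ab'(1) inv_closed[OF ab'(2)]] q.hom_inv[OF ab'(2)] eq by simp_all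
        note this(2)
        also have "\<dots> = N" using q.H.r_inv[OF q.hom_closed[OF ab'(2)]] by simp
        finally show ?thesis using N.coset_eq_self_iff[OF \<open>?k \<in> carrier G\<close>] by blast
      qed
      then have "derived_set G (carrier G) \<subseteq> N" by blast
      then have "derived G (carrier G) \<subseteq> N"
        unfolding derived_def by (rule generate_subgroup_incl[OF _ N.subgroup_axioms])
      then show ?thesis
        using exists_rank_two_abelian_quotient[OF assms(1) exponent class_2 not_cyclic N(1) _ g(1) N(2) max]
        by blast
    qed
  qed
  then show ?thesis using residually_capable_imp_capable[OF assms(3)] by blast
qed simp

end
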